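(* Independent Set and Clique can be solved in time $2^k\cdot n^{O(1)}$ and polynomial space on $n$-vertex graphs $G=(V,E)$ given together with a set $X\subseteq V$, $|X|\le k$, such that $G\setminus X$ is an interval graph.
   Context: Independent Set (resp. Clique): given $G$ and a positive integer $p$, decide whether $G$ has a set of $p$ pairwise nonadjacent (resp. pairwise adjacent) vertices. *)

theory Defs
  imports
    "Graph_Theory.Pair_Digraph"
    "Graph_Theory.Digraph_Component"
    "HOL-Library.Discrete_Functions"
    "HOL-Library.Landau_Symbols"
begin

section \<open>Graphs\<close>

text \<open>
  A finite simple undirected graph is a finite, loop-free, symmetric digraph without parallel
  arcs, i.e. \<^const>\<open>pair_graph\<close>; every edge is present as a pair of opposite arcs.
\<close>

definition independent_in :: "('a, 'b) pre_digraph \<Rightarrow> 'a set \<Rightarrow> bool" where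
  "independent_in G S \<longleftrightarrow> S \<subseteq> verts G \<and> (\<forall>u\<in>S. \<forall>v\<in>S. u \<noteq> v \<longrightarrow> \<not> u \<rightarrow>\<^bsub>G\<^esub> v)"

definition clique_in :: "('a, 'b) pre_digraph \<Rightarrow> 'a set \<Rightarrow> bool" where
  "clique_in G S \<longleftrightarrow> S \<subseteq> verts G \<and> (\<forall>u\<in>S. \<forall>v\<in>S. u \<noteq> v \<longrightarrow> u \<rightarrow>\<^bsub>G\<^esub> v)"

definition delete_verts :: "('a, 'b) pre_digraph \<Rightarrow> 'a set \<Rightarrow> ('a, 'b) pre_digraph" where
  "delete_verts G X = G \<restriction> (verts G - X)"

definition interval_graph :: "('a, 'b) pre_digraph \<Rightarrow> bool" where
  "interval_graph G \<longleftrightarrow> graph G \<and>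
     (\<exists>l r :: 'a \<Rightarrow> real.
        (\<forall>v\<in>verts G. l v \<le> r v) \<and>
        (\<forall>u\<in>verts G. \<forall>v\<in>verts G. u \<noteq> v \<longrightarrow>
           (u \<rightarrow>\<^bsub>G\<^esub> v \<longleftrightarrow> {l u..r u} \<inter> {l v..r v} \<noteq> {})))"


section \<open>Random access machines\<close>

text \<open>
  A random access machine with registers indexed by and containing natural numbers, a read-only
  input consisting of bits, and addition and (truncated) subtraction as its only arithmetic.
  \<open>Load\<close>, \<open>Store\<close> and \<open>Read\<close> address indirectly. Time and space are measured
  under the logarithmic cost criterion, so that both are polynomially related to those of
  Turing machines: one step of cost \<open>c\<close> in space \<open>s\<close> takes a Turing machine time polynomial
  in \<open>c\<close>, \<open>s\<close> and the length of the input.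
\<close>

datatype instr =
    Const nat nat
  | Add nat nat nat
  | Sub nat nat nat
  | Load nat nat
  | Store nat nat
  | Read nat nat
  | Jz nat nat

type_synonym config = "nat \<times> (nat \<Rightarrow> nat)"

text \<open>Reading beyond the end of the input yields the end marker 2.\<close>

definition input_symbol :: "bool list \<Rightarrow> nat \<Rightarrow> nat" where
  "input_symbol w i = (if i < length w then of_bool (w ! i) else 2)"

fun exec_instr :: "bool list \<Rightarrow> instr \<Rightarrow> config \<Rightarrow> config" where
  "exec_instr w (Const d c) (pc, R) = (Suc pc, R(d := c))"
| "exec_instr w (Add d a b) (pc, R) = (Suc pc, R(d := R a + R b))"
| "exec_instr w (Sub d a b) (pc, R) = (Suc pc, R(d := R a - R b))"
| "exec_instr w (Load d a) (pc, R) = (Suc pc, R(d := R (R a)))"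
| "exec_instr w (Store d a) (pc, R) = (Suc pc, R(R d := R a))"
| "exec_instr w (Read d a) (pc, R) = (Suc pc, R(d := input_symbol w (R a)))"
| "exec_instr w (Jz a t) (pc, R) = ((if R a = 0 then t else Suc pc), R)"

text \<open>The length of the binary representation, where 0 has length 1.\<close>

definition bit_length :: "nat \<Rightarrow> nat" where
  "bit_length m = Suc (floor_log m)"

fun instr_cost :: "instr \<Rightarrow> (nat \<Rightarrow> nat) \<Rightarrow> nat" where
  "instr_cost (Const d c) R = bit_length d + bit_length c"
| "instr_cost (Add d a b) R =
     bit_length d + bit_length a + bit_length b + bit_length (R a) + bit_length (R b)"
| "instr_cost (Sub d a b) R =
     bit_length d + bit_length a + bit_length b + bit_length (R a) + bit_length (R b)"
| "instr_cost (Load d a) R =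
     bit_length d + bit_length a + bit_length (R a) + bit_length (R (R a))"
| "instr_cost (Store d a) R =
     bit_length d + bit_length a + bit_length (R d) + bit_length (R a)"
| "instr_cost (Read d a) R = bit_length d + bit_length a + bit_length (R a)"
| "instr_cost (Jz a t) R = bit_length a + bit_length (R a)"

definition halted :: "instr list \<Rightarrow> config \<Rightarrow> bool" where
  "halted prog cf \<longleftrightarrow> length prog \<le> fst cf"

definition step :: "instr list \<Rightarrow> bool list \<Rightarrow> config \<Rightarrow> config" where
  "step prog w cf = (if halted prog cf then cf else exec_instr w (prog ! fst cf) cf)"

definition step_cost :: "instr list \<Rightarrow> config \<Rightarrow> nat" where
  "step_cost prog cf = (if halted prog cf then 0 else instr_cost (prog ! fst cf) (snd cf))"

definition config_after :: "instr list \<Rightarrow> bool list \<Rightarrow> nat \<Rightarrow> config" where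
  "config_after prog w i = (step prog w ^^ i) (0, \<lambda>_. 0)"

text \<open>
  Only finitely many registers are nonzero in a reachable configuration, so the sum below is
  never the default value for infinite index sets.
\<close>

definition config_space :: "config \<Rightarrow> nat" where
  "config_space cf = (\<Sum>a | snd cf a \<noteq> 0. bit_length a + bit_length (snd cf a))"

text \<open>
  On input \<open>w\<close> the program halts with answer \<open>ans\<close> in register 0, in time at most \<open>T\<close>
  and space at most \<open>S\<close>.
\<close>

definition decides_within ::
  "instr list \<Rightarrow> bool list \<Rightarrow> bool \<Rightarrow> nat \<Rightarrow> nat \<Rightarrow> bool" where
  "decides_within prog w ans T S \<longleftrightarrow>
     (\<exists>m. halted prog (config_after prog w m) \<and>
          snd (config_after prog w m) 0 = of_bool ans \<and>
          (\<Sum>i<m. step_cost prog (config_after prog w i)) \<le> T \<and>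
          (\<forall>i\<le>m. config_space (config_after prog w i) \<le> S))"

definition poly_bounded :: "(nat \<Rightarrow> nat) \<Rightarrow> bool" where
  "poly_bounded t \<longleftrightarrow> (\<exists>d::nat. (\<lambda>n. real (t n)) \<in> O(\<lambda>n. real n ^ d))"


section \<open>Encoding of instances\<close>

text \<open>
  The vertices are numbered in increasing order. The input consists of the number of vertices
  in unary followed by a 0, the rows of the adjacency matrix, the characteristic vector of
  \<open>X\<close>, and the binary digits of \<open>p\<close>, least significant first and without leading zeros.
\<close>

definition encode_instance :: "nat pair_pre_digraph \<Rightarrow> nat set \<Rightarrow> nat \<Rightarrow> bool list" where
  "encode_instance G X p =
     (let vs = sorted_list_of_set (pverts G) in
        replicate (length vs) True @ [False] @
        concat (map (\<lambda>u. map (\<lambda>v. (u, v) \<in> parcs G) vs) vs) @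
        map (\<lambda>v. v \<in> X) vs @
        map (bit p) [0..<bit_length p])"

end

theory Submission
  imports Defs
begin

text \<open>
  Branch over the subsets Y of X. If Y is pairwise compatible (independent, or a clique), the
  best extension of Y lies among the vertices outside X that are compatible with Y, and these
  induce an interval graph. There a vertex v with the leftmost right endpoint is simplicial, that
  is, its neighbourhood is a clique. Hence some maximum independent set contains v and avoids its
  neighbours, while a maximum clique is either the closed neighbourhood of v or avoids v.
  Eliminating simplicial vertices one by one, which needs no interval representation, therefore
  settles each of the at most \<open>2 ^ k\<close> branches in polynomial time. The subsets are enumerated
  by a binary counter, so polynomial space suffices.
\<close>

section \<open>Simplicial elimination\<close>

text \<open>The time bound is \<open>2 ^ k\<close> times a polynomial in n, whereas p is given in
  binary and may have arbitrarily many digits. The program therefore reads only the first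
  \<open>n + 2\<close> digits of p, which already decide how p compares with numbers up to n. Costs
  are controlled by a loop language in which arithmetic saturates at a bound N, quadratic in n, and
  every loop makes at most N iterations. A polynomial bound then follows from the syntax of a
  command alone, and correctness amounts to showing that saturation does no harm. Two loops stay
  outside this language and are closed by machine jumps: the count of the vertices, which produces N
  in the first place, and the enumeration of subsets, whose \<open>2 ^ k\<close> rounds no bounded
  loop could make. Both problems are treated at once: \<open>pairwise P\<close> describes cliques if
  P is adjacency and independent sets if P is nonadjacency. A flag selects P and the matching
  elimination step.\<close>

definition max_pairwise :: "('a \<Rightarrow> 'a \<Rightarrow> bool) \<Rightarrow> 'a set \<Rightarrow> nat" where
  "max_pairwise P A = Max (card ` {S. S \<subseteq> A \<and> pairwise P S})"

lemma card_le_max_pairwise: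
  assumes "finite A" "S \<subseteq> A" "pairwise P S"
  shows "card S \<le> max_pairwise P A"
  unfolding max_pairwise_def using assms by (intro Max_ge) auto

lemma max_pairwise_attained:
  assumes "finite A"
  obtains S where "S \<subseteq> A" "pairwise P S" "card S = max_pairwise P A"
proof -
  have "max_pairwise P A \<in> card ` {S. S \<subseteq> A \<and> pairwise P S}"
    unfolding max_pairwise_def
  proof (rule Max_in)
    have "{} \<in> {S. S \<subseteq> A \<and> pairwise P S}" by (simp add: pairwise_def)
    then show "card ` {S. S \<subseteq> A \<and> pairwise P S} \<noteq> {}" by blast
  qed (use assms in auto)
  then show thesis using that by auto
qed

lemma max_pairwise_le:
  assumes "finite A" and "\<And>S. S \<subseteq> A \<Longrightarrow> pairwise P S \<Longrightarrow> card S \<le> m"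
  shows "max_pairwise P A \<le> m"
proof -
  obtain S where "S \<subseteq> A" "pairwise P S" "card S = max_pairwise P A"
    by (rule max_pairwise_attained[OF assms(1)])
  then show ?thesis using assms(2) by metis
qed

lemma max_pairwise_empty [simp]: "max_pairwise P {} = 0"
  using max_pairwise_le[of "{}" P 0] by simp

lemma max_pairwise_le_card: "finite A \<Longrightarrow> max_pairwise P A \<le> card A"
  by (rule max_pairwise_le) (auto intro: card_mono)

text \<open>Subsets inherit \<open>pairwise\<close>, so a maximum set can be thinned out to any
  smaller size. This reduces the decision problem to computing a maximum.\<close>

lemma ex_pairwise_card_iff:
  assumes "finite A"
  shows "(\<exists>S. S \<subseteq> A \<and> pairwise P S \<and> card S = p) \<longleftrightarrow> p \<le> max_pairwise P A"
proof
  assume "p \<le> max_pairwise P A"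
  moreover obtain S where S: "S \<subseteq> A" "pairwise P S" "card S = max_pairwise P A"
    by (rule max_pairwise_attained[OF assms])
  ultimately obtain T where "T \<subseteq> S" "card T = p" by (metis obtain_subset_with_card_n)
  with S show "\<exists>S. S \<subseteq> A \<and> pairwise P S \<and> card S = p"
    by (intro exI[of _ T]) (auto intro: pairwise_subset)
qed (use card_le_max_pairwise[OF assms] in blast)

definition simplicial :: "('a \<Rightarrow> 'a \<Rightarrow> bool) \<Rightarrow> 'a set \<Rightarrow> 'a \<Rightarrow> bool" where
  "simplicial E A v \<longleftrightarrow> (\<forall>a\<in>A. \<forall>b\<in>A. E v a \<longrightarrow> E v b \<longrightarrow> a \<noteq> b \<longrightarrow> E a b)"

text \<open>Some maximum independent set contains a given simplicial vertex.\<close>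

lemma max_independent_simplicial:
  assumes fin: "finite A" and sym: "\<And>u v. E u v \<longleftrightarrow> E v u"
    and v: "v \<in> A" "simplicial E A v"
  shows "max_pairwise (\<lambda>u v. \<not> E u v) A =
    Suc (max_pairwise (\<lambda>u v. \<not> E u v) {u \<in> A. u \<noteq> v \<and> \<not> E v u})"
    (is "?m A = Suc (?m ?B)")
proof (rule antisym)
  have finB: "finite ?B" using fin by simp
  show "?m A \<le> Suc (?m ?B)"
  proof (rule max_pairwise_le[OF fin])
    fix S assume S: "S \<subseteq> A" "pairwise (\<lambda>u v. \<not> E u v) S"
    \<comment> \<open>Exchange argument: \<open>?T\<close> is what S loses when its part in the
      closed neighbourhood of v is traded for v. It has at most one element because that
      neighbourhood is a clique.\<close>
    let ?T = "{u \<in> S. u = v \<or> E v u}"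
    have finS: "finite S" using S fin by (auto intro: finite_subset)
    have "a = b" if "a \<in> ?T" "b \<in> ?T" for a b
    proof (rule ccontr)
      assume "a \<noteq> b"
      then have "\<not> E a b" "\<not> E b a" using that S by (auto simp: pairwise_def)
      then show False using that v S \<open>a \<noteq> b\<close> unfolding simplicial_def by blast
    qed
    then have "card ?T \<le> 1" using finS by (auto simp: card_le_Suc0_iff_eq)
    moreover have "card (S - ?T) \<le> ?m ?B"
      by (rule card_le_max_pairwise[OF finB]) (use S in \<open>auto simp: pairwise_def\<close>)
    moreover have "card S = card ?T + card (S - ?T)"
      using finS card_mono[of S ?T] by (subst card_Diff_subset) auto
    ultimately show "card S \<le> Suc (?m ?B)" by simp
  qed
  obtain S where S: "S \<subseteq> ?B" "pairwise (\<lambda>u v. \<not> E u v) S" "card S = ?m ?B"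
    by (rule max_pairwise_attained[OF finB])
  have "card (insert v S) \<le> ?m A"
    by (rule card_le_max_pairwise[OF fin]) (use S v sym in \<open>auto simp: pairwise_def\<close>)
  moreover have "finite S" "v \<notin> S" using S finB by (auto intro: finite_subset)
  ultimately show "Suc (?m ?B) \<le> ?m A" using S(3) by simp
qed

text \<open>A clique through v lies in the closed neighbourhood of v, which is itself a clique; all
  other cliques survive the deletion of v.\<close>

lemma max_clique_simplicial:
  assumes fin: "finite A" and sym: "\<And>u v. E u v \<longleftrightarrow> E v u"
    and v: "v \<in> A" "simplicial E A v"
  shows "max_pairwise E A = max (card {u \<in> A. u = v \<or> E v u}) (max_pairwise E (A - {v}))"
    (is "_ = max (card ?N) ?m")
proof (rule antisym)
  show "max_pairwise E A \<le> max (card ?N) ?m"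
  proof (rule max_pairwise_le[OF fin])
    fix S assume S: "S \<subseteq> A" "pairwise E S"
    show "card S \<le> max (card ?N) ?m"
    proof (cases "v \<in> S")
      case True
      then have "S \<subseteq> ?N" using S by (auto simp: pairwise_def)
      then have "card S \<le> card ?N" using fin by (intro card_mono) auto
      then show ?thesis by simp
    next
      case False
      then have "card S \<le> ?m" using S fin by (intro card_le_max_pairwise) auto
      then show ?thesis by simp
    qed
  qed
  have "card ?N \<le> max_pairwise E A"
    using fin v sym by (intro card_le_max_pairwise) (auto simp: pairwise_def simplicial_def)
  moreover have "?m \<le> max_pairwise E A"
    using fin by (intro max_pairwise_le card_le_max_pairwise) auto
  ultimately show "max (card ?N) ?m \<le> max_pairwise E A" by simp
qed

text \<open>A vertex whose interval has the leftmost right endpoint is simplicial.\<close>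

lemma interval_model_simplicial:
  fixes l r :: "'a \<Rightarrow> real"
  assumes "finite A" "A \<noteq> {}"
    and "\<And>v. v \<in> A \<Longrightarrow> l v \<le> r v"
    and E: "\<And>u v. u \<in> A \<Longrightarrow> v \<in> A \<Longrightarrow> u \<noteq> v \<Longrightarrow> E u v \<longleftrightarrow> {l u..r u} \<inter> {l v..r v} \<noteq> {}"
    and irr: "\<And>v. \<not> E v v"
  shows "\<exists>v\<in>A. simplicial E A v"
proof -
  obtain v where v: "v \<in> A" "\<And>u. u \<in> A \<Longrightarrow> r v \<le> r u"
    using arg_min_if_finite[OF assms(1,2), of r] by (metis linorder_not_less)
  \<comment> \<open>A neighbour a of v meets the interval of v, so \<open>l a <= r v\<close>, and
    \<open>r v <= r a\<close> by the choice of v. All neighbours thus share the point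
    \<open>r v\<close>.\<close>
  have nb: "r v \<in> {l a..r a}" if a: "a \<in> A" "E v a" for a
  proof -
    have "{l v..r v} \<inter> {l a..r a} \<noteq> {}" using E[of v a] a v(1) irr by blast
    then show ?thesis using v(2)[OF a(1)] by auto
  qed
  have "E a b" if "a \<in> A" "b \<in> A" "E v a" "E v b" "a \<noteq> b" for a b
    using E[of a b] nb that by blast
  then show ?thesis using v(1) unfolding simplicial_def by blast
qed


section \<open>Branching on the modulator\<close>

definition extenders :: "('a \<Rightarrow> 'a \<Rightarrow> bool) \<Rightarrow> 'a set \<Rightarrow> 'a set \<Rightarrow> 'a set" where
  "extenders P B Y = {u \<in> B. \<forall>v\<in>Y. P u v}"

text \<open>The value 0 is neutral for the maximum, so all subsets can be enumerated without
  filtering.\<close>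

definition branch_value :: "('a \<Rightarrow> 'a \<Rightarrow> bool) \<Rightarrow> 'a set \<Rightarrow> 'a set \<Rightarrow> nat" where
  "branch_value P B Y =
     (if pairwise P Y then card Y + max_pairwise P (extenders P B Y) else 0)"

text \<open>An optimal S is found in the branch of its trace on X, because \<open>S - X\<close>
  consists of extenders of that trace. The inserted 0 is the value from which the enumeration
  starts, before any branch is explored.\<close>

lemma max_pairwise_branch:
  assumes fin: "finite V" and X: "X \<subseteq> V" and sym: "\<And>u v. P u v \<longleftrightarrow> P v u"
  shows "Max (insert 0 (branch_value P (V - X) ` Pow X)) = max_pairwise P V"
proof (rule Max_eqI)
  have finX: "finite X" using fin X by (rule finite_subset[rotated])
  show "finite (insert 0 (branch_value P (V - X) ` Pow X))" using finX by simp
  have finE: "finite (extenders P (V - X) Y)" for Y using fin by (simp add: extenders_def)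
  have le: "branch_value P (V - X) Y \<le> max_pairwise P V" if Y: "Y \<subseteq> X" for Y
  proof (cases "pairwise P Y")
    case True
    obtain S where S: "S \<subseteq> extenders P (V - X) Y" "pairwise P S"
        "card S = max_pairwise P (extenders P (V - X) Y)"
      by (rule max_pairwise_attained[OF finE])
    have "P u v \<and> P v u" if "u \<in> S" "v \<in> Y" for u v
      using that S(1) sym[of u v] by (auto simp: extenders_def)
    then have "pairwise P (Y \<union> S)" using S True by (auto simp: pairwise_def)
    then have "card (Y \<union> S) \<le> max_pairwise P V"
      by (intro card_le_max_pairwise[OF fin]) (use S Y X in \<open>auto simp: extenders_def\<close>)
    moreover have "card (Y \<union> S) = card Y + card S"
      by (rule card_Un_disjoint)
        (use S Y X finE finX in \<open>auto simp: extenders_def intro: finite_subset\<close>)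
    ultimately show ?thesis using S(3) True by (simp add: branch_value_def)
  qed (simp add: branch_value_def)
  then show "y \<le> max_pairwise P V" if "y \<in> insert 0 (branch_value P (V - X) ` Pow X)" for y
    using that by auto
  obtain S where S: "S \<subseteq> V" "pairwise P S" "card S = max_pairwise P V"
    by (rule max_pairwise_attained[OF fin])
  let ?Y = "S \<inter> X"
  have "card (S - X) \<le> max_pairwise P (extenders P (V - X) ?Y)"
    by (rule card_le_max_pairwise[OF finE])
      (use S in \<open>auto simp: extenders_def pairwise_def\<close>)
  moreover have "card S = card ?Y + card (S - X)"
  proof -
    have "finite S" using S fin by (auto intro: finite_subset)
    then show ?thesis by (metis Diff_Diff_Int Diff_subset add.commute card_Diff_subset
      card_mono finite_Diff le_add_diff_inverse2)
  qed
  moreover have "pairwise P ?Y" using S by (auto simp: pairwise_def)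
  ultimately have "max_pairwise P V \<le> branch_value P (V - X) ?Y"
    using S(3) by (simp add: branch_value_def)
  then have "max_pairwise P V = branch_value P (V - X) ?Y" using le[of ?Y] by simp
  then show "max_pairwise P V \<in> insert 0 (branch_value P (V - X) ` Pow X)" by blast
qed

section \<open>Enumeration of the subsets of X in binary order\<close>

definition colex_less :: "nat set \<Rightarrow> nat set \<Rightarrow> bool" where
  "colex_less Y Z \<longleftrightarrow> (\<exists>m. m \<in> Z \<and> m \<notin> Y \<and> (\<forall>x>m. x \<in> Y \<longleftrightarrow> x \<in> Z))"

text \<open>With sets read as binary numbers, \<open>colex_less\<close> is the numerical order;
  these are the subsets already handled when the counter shows Y.\<close>

definition colex_below :: "nat set \<Rightarrow> nat set \<Rightarrow> nat set set" where
  "colex_below X Y = {Z. Z \<subseteq> X \<and> colex_less Z Y}"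

lemma colex_below_empty [simp]: "colex_below X {} = {}"
  by (simp add: colex_below_def colex_less_def)

lemma colex_less_irrefl: "\<not> colex_less Y Y"
  by (auto simp: colex_less_def)

text \<open>The largest element missing from Z is the leading digit in which the two sets differ. In
  particular X comes last among its subsets.\<close>

lemma colex_less_if_psubset:
  assumes "finite Y" "Z \<subset> Y"
  shows "colex_less Z Y"
proof -
  let ?m = "Max (Y - Z)"
  have "?m \<in> Y - Z" using assms by (intro Max_in) auto
  moreover have "x \<in> Z \<longleftrightarrow> x \<in> Y" if "x > ?m" for x
    using that assms Max_ge[of "Y - Z" x] by fastforce
  ultimately show ?thesis unfolding colex_less_def by blast
qed

text \<open>Incrementing a binary counter moves to the next subset of X in the colexicographic order.\<close>

lemma colex_below_successor:
  assumes fin: "finite X" and Y: "Y \<subseteq> X" and m: "m \<in> X" "m \<notin> Y"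
    and below: "\<And>x. x \<in> X \<Longrightarrow> x < m \<Longrightarrow> x \<in> Y"
  shows "colex_below X (insert m {x \<in> Y. m < x}) = insert Y (colex_below X Y)"
    (is "colex_below X ?Y' = _")
proof (intro set_eqI iffI)
  fix Z assume "Z \<in> colex_below X ?Y'"
  then obtain k where Z: "Z \<subseteq> X" and k: "k \<in> ?Y'" "k \<notin> Z" "\<And>x. x > k \<Longrightarrow> x \<in> Z \<longleftrightarrow> x \<in> ?Y'"
    by (auto simp: colex_below_def colex_less_def)
  show "Z \<in> insert Y (colex_below X Y)"
  proof (cases "k = m")
    case True
    \<comment> \<open>Above m the set Z agrees with Y, m itself is not in Z, and below m all of X is
      in Y.\<close>
    have "Z \<subseteq> Y"
    proof
      fix x assume "x \<in> Z"
      then show "x \<in> Y" using k True Z below by (cases x m rule: linorder_cases) auto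
    qed
    then show ?thesis using colex_less_if_psubset[of Y Z] Z fin Y
      by (auto simp: colex_below_def intro: finite_subset)
  next
    case False
    then have "k \<in> Y" "m < k" using k by auto
    then have "colex_less Z Y" unfolding colex_less_def
      using k(2,3) by (intro exI[of _ k]) auto
    then show ?thesis using Z by (simp add: colex_below_def)
  qed
next
  fix Z assume "Z \<in> insert Y (colex_below X Y)"
  then consider "Z = Y" | "Z \<subseteq> X" "colex_less Z Y" by (auto simp: colex_below_def)
  then show "Z \<in> colex_below X ?Y'"
  proof cases
    case 1
    have "colex_less Y ?Y'" unfolding colex_less_def using m by (intro exI[of _ m]) auto
    then show ?thesis using 1 Y by (simp add: colex_below_def)
  next
    case 2
    then obtain k where k: "k \<in> Y" "k \<notin> Z" "\<And>x. x > k \<Longrightarrow> x \<in> Z \<longleftrightarrow> x \<in> Y"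
      by (auto simp: colex_less_def)
    have "k \<noteq> m" using k m by blast
    \<comment> \<open>If k lies below m, the leading difference moves up to m: Z agrees with Y
      there, so m is not in Z.\<close>
    then have "colex_less Z ?Y'" unfolding colex_less_def
      using k m by (intro exI[of _ "max k m"]) (auto simp: max_def)
    then show ?thesis using 2 by (simp add: colex_below_def)
  qed
qed

lemma colex_below_full:
  assumes "finite X"
  shows "insert X (colex_below X X) = Pow X"
  using colex_less_if_psubset[OF assms] by (auto simp: colex_below_def)

section \<open>A loop language with saturating arithmetic\<close>

text \<open>
  All values are kept at most N by saturating addition, so values, addresses, and the number
  of iterations of every loop are bounded by construction, and the running time of a command
  is bounded independently of the store.
\<close>

datatype loc = V nat | T nat | Arr bool nat

type_synonym store = "loc \<Rightarrow> nat"

datatype com =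
    Skip
  | Flag loc bool
  | Plus loc loc loc
  | Minus loc loc loc
  | Input loc loc
  | Get bool loc loc
  | Put bool loc loc
  | Seq com com (infixr \<open>;;\<close> 60)
  | Cond loc com com
  | Loop loc loc com

text \<open>Only \<open>Plus\<close> can exceed N and needs saturation; input symbols are at most 2.
  A loop fixes its number of iterations on entry and sets its index anew each time, so the body
  cannot prolong it.\<close>

primrec sem :: "bool list \<Rightarrow> nat \<Rightarrow> com \<Rightarrow> store \<Rightarrow> store" where
  "sem w N Skip s = s"
| "sem w N (Flag x b) s = s(x := of_bool b)"
| "sem w N (Plus x y z) s = s(x := min N (s y + s z))"
| "sem w N (Minus x y z) s = s(x := s y - s z)"
| "sem w N (Input x y) s = s(x := input_symbol w (s y))"
| "sem w N (Get a x y) s = s(x := s (Arr a (s y)))"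
| "sem w N (Put a x y) s = s(Arr a (s x) := s y)"
| "sem w N (c1 ;; c2) s = sem w N c2 (sem w N c1 s)"
| "sem w N (Cond x c1 c2) s = (if s x \<noteq> 0 then sem w N c1 s else sem w N c2 s)"
| "sem w N (Loop x y c) s = fold (\<lambda>i s'. sem w N c (s'(x := i))) [0..<s y] s"

lemma sem_le:
  assumes "2 \<le> N" "\<And>l. s l \<le> N"
  shows "sem w N c s l \<le> N"
  using assms(2)
proof (induction c arbitrary: s l)
  case (Minus x y z)
  then show ?case by (auto intro: le_trans[OF diff_le_self])
next
  case (Loop x y c)
  have "fold (\<lambda>i s'. sem w N c (s'(x := i))) is s' l \<le> N"
    if "\<And>l. s' l \<le> N" "set is \<subseteq> {..<s y}" for "is" s' l
    using that
  proof (induction "is" arbitrary: s')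
    case (Cons i "is")
    have "(s'(x := i)) l \<le> N" for l
      using Cons.prems Loop.prems[of y] by auto
    then show ?case using Cons Loop.IH by auto
  qed simp
  from this[of s "[0..<s y]"] show ?case using Loop.prems by (auto simp: subset_eq)
qed (use assms(1) in \<open>auto simp: input_symbol_def\<close>)

lemma sem_Loop_invariant:
  assumes "I 0 s" "\<And>i t. i < s y \<Longrightarrow> I i t \<Longrightarrow> I (Suc i) (sem w N c (t(x := i)))"
  shows "I (s y) (sem w N (Loop x y c) s)"
proof -
  have "I m (fold (\<lambda>i s'. sem w N c (s'(x := i))) [0..<m] s)" if "m \<le> s y" for m
    using that by (induction m) (use assms in auto)
  then show ?thesis by simp
qed

text \<open>The index written by \<open>Put\<close> is known only at run time, so the whole array
  counts as modified.\<close>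

primrec mods :: "com \<Rightarrow> loc set" where
  "mods Skip = {}"
| "mods (Flag x b) = {x}"
| "mods (Plus x y z) = {x}"
| "mods (Minus x y z) = {x}"
| "mods (Input x y) = {x}"
| "mods (Get a x y) = {x}"
| "mods (Put a x y) = range (Arr a)"
| "mods (c1 ;; c2) = mods c1 \<union> mods c2"
| "mods (Cond x c1 c2) = mods c1 \<union> mods c2"
| "mods (Loop x y c) = insert x (mods c)"

lemma sem_frame: "l \<notin> mods c \<Longrightarrow> sem w N c s l = s l"
proof (induction c arbitrary: s)
  case (Loop x y c)
  show ?case
    using sem_Loop_invariant[where I = "\<lambda>_ t. t l = s l" and s = s and c = c and x = x and y = y]
      Loop by auto
qed auto

text \<open>Invariants need to mention only what the body changes; everything else may be looked up
  in the store at loop entry.\<close>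

lemma sem_Loop_invariant_frame:
  assumes "I 0 s"
    and "\<And>i t. i < s y \<Longrightarrow> I i t \<Longrightarrow> (\<And>l. l \<noteq> x \<Longrightarrow> l \<notin> mods c \<Longrightarrow> t l = s l) \<Longrightarrow>
      I (Suc i) (sem w N c (t(x := i)))"
  shows "I (s y) (sem w N (Loop x y c) s)"
proof -
  have "(\<lambda>i t. I i t \<and> (\<forall>l. l \<noteq> x \<longrightarrow> l \<notin> mods c \<longrightarrow> t l = s l)) (s y) (sem w N (Loop x y c) s)"
    by (rule sem_Loop_invariant[where I = "\<lambda>i t. I i t \<and> (\<forall>l. l \<noteq> x \<longrightarrow> l \<notin> mods c \<longrightarrow> t l = s l)"])
      (use assms in \<open>auto simp: sem_frame\<close>)
  then show ?thesis by blast
qed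

text \<open>Machine steps, bounded for all stores at once; hence both branches of
  \<open>Cond\<close> are added up. A loop spends six instructions per iteration around its body,
  two on setting up and two on the final failing test.\<close>

primrec time :: "nat \<Rightarrow> com \<Rightarrow> nat" where
  "time N Skip = 0"
| "time N (Flag x b) = 1"
| "time N (Plus x y z) = 3"
| "time N (Minus x y z) = 1"
| "time N (Input x y) = 1"
| "time N (Get a x y) = 5"
| "time N (Put a x y) = 5"
| "time N (c1 ;; c2) = time N c1 + time N c2"
| "time N (Cond x c1 c2) = time N c1 + time N c2 + 2"
| "time N (Loop x y c) = N * (time N c + 6) + 4"


section \<open>Compilation to random access machines\<close>

text \<open>
  Registers 1 and 5 hold N and 0, registers 9 and 13 are scratch, and the remaining registers
  congruent to 1 modulo 4 hold the counters and limits of the loops by nesting depth.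
\<close>

fun addr :: "loc \<Rightarrow> nat" where
  "addr (V j) = 8 * j"
| "addr (T j) = 8 * j + 4"
| "addr (Arr a i) = 4 * i + 2 + of_bool a"

text \<open>Counters and limits have residues 1 and 5 modulo 8 and start above the registers 1, 5, 9
  and 13, so nothing collides.\<close>

definition counter :: "nat \<Rightarrow> nat" where "counter d = 8 * d + 17"
definition limit :: "nat \<Rightarrow> nat" where "limit d = 8 * d + 21"

text \<open>Jump targets are absolute, hence the argument \<open>pc\<close>. Saturation is
  \<open>a - (a - N)\<close> with truncated subtraction. Register 5 holds 0, so \<open>Add\<close>
  with it copies and \<open>Jz 5\<close> jumps unconditionally. Array addresses are formed by
  doubling twice.\<close>

primrec code :: "com \<Rightarrow> nat \<Rightarrow> nat \<Rightarrow> instr list" where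
  "code Skip d pc = []"
| "code (Flag x b) d pc = [Const (addr x) (of_bool b)]"
| "code (Plus x y z) d pc = [Add 9 (addr y) (addr z), Sub 13 9 1, Sub (addr x) 9 13]"
| "code (Minus x y z) d pc = [Sub (addr x) (addr y) (addr z)]"
| "code (Input x y) d pc = [Read (addr x) (addr y)]"
| "code (Get a x y) d pc =
    [Add 9 (addr y) (addr y), Add 9 9 9, Const 13 (2 + of_bool a), Add 9 9 13, Load (addr x) 9]"
| "code (Put a x y) d pc =
    [Add 9 (addr x) (addr x), Add 9 9 9, Const 13 (2 + of_bool a), Add 9 9 13, Store 9 (addr y)]"
| "code (c1 ;; c2) d pc = code c1 d pc @ code c2 d (pc + length (code c1 d pc))"
| "code (Cond x c1 c2) d pc =
    (let k1 = code c1 d (Suc pc); pc2 = pc + 2 + length k1; k2 = code c2 d pc2 in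
     Jz (addr x) pc2 # k1 @ Jz 5 (pc2 + length k2) # k2)"
| "code (Loop x y c) d pc =
    (let k = code c (Suc d) (pc + 5) in
     [Const (counter d) 0, Add (limit d) (addr y) 5, Sub 9 (limit d) (counter d),
      Jz 9 (pc + 8 + length k), Add (addr x) (counter d) 5] @ k @
     [Const 9 1, Add (counter d) (counter d) 9, Jz 5 (pc + 2)])"

text \<open>Variables occupy multiples of 4 and the two arrays the residues 2 and 3, which leaves
  residue 1 to the bookkeeping of the compiled code.\<close>

lemma addr_mod: "addr l mod 4 \<noteq> 1"
  by (cases l) (auto, presburger+)

lemma addr_neq [simp]:
  "addr l \<noteq> Suc 0" "addr l \<noteq> 5" "addr l \<noteq> 9" "addr l \<noteq> 13"
  "addr l \<noteq> counter d" "addr l \<noteq> limit d"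
  "Suc 0 \<noteq> addr l" "5 \<noteq> addr l" "9 \<noteq> addr l" "13 \<noteq> addr l"
  "counter d \<noteq> addr l" "limit d \<noteq> addr l"
  using addr_mod[of l] by (auto simp: counter_def limit_def) presburger+

lemma counter_neq [simp]:
  "counter d \<noteq> Suc 0" "counter d \<noteq> 5" "counter d \<noteq> 9" "counter d \<noteq> 13"
  "limit d \<noteq> Suc 0" "limit d \<noteq> 5" "limit d \<noteq> 9" "limit d \<noteq> 13"
  "Suc 0 \<noteq> counter d" "5 \<noteq> counter d" "9 \<noteq> counter d" "13 \<noteq> counter d"
  "Suc 0 \<noteq> limit d" "5 \<noteq> limit d" "9 \<noteq> limit d" "13 \<noteq> limit d"
  "counter d = counter e \<longleftrightarrow> d = e" "limit d = limit e \<longleftrightarrow> d = e"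
  "counter d \<noteq> limit e" "limit d \<noteq> counter e"
  by (simp_all add: counter_def limit_def) presburger+

lemma addr_eq_iff [simp]: "addr l = addr l' \<longleftrightarrow> l = l'"
  by (cases l; cases l') (auto split: if_splits, presburger+)

text \<open>Covers the operands that are charged by the cost measure or stored; a jump target is
  neither.\<close>

fun operand_bound :: "instr \<Rightarrow> nat" where
  "operand_bound (Const d c) = max d c"
| "operand_bound (Add d a b) = max d (max a b)"
| "operand_bound (Sub d a b) = max d (max a b)"
| "operand_bound (Load d a) = max d a"
| "operand_bound (Store d a) = max d a"
| "operand_bound (Read d a) = max d a"
| "operand_bound (Jz a t) = a"

section \<open>Machine runs within bounded registers, and simulation of commands\<close>

definition fits :: "nat \<Rightarrow> (nat \<Rightarrow> nat) \<Rightarrow> bool" where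
  "fits B R \<longleftrightarrow> (\<forall>a. R a \<le> B \<and> (B < a \<longrightarrow> R a = 0))"

lemma fits_upd: "fits B R \<Longrightarrow> d \<le> B \<Longrightarrow> v \<le> B \<Longrightarrow> fits B (R(d := v))"
  by (auto simp: fits_def)

definition code_at :: "instr list \<Rightarrow> nat \<Rightarrow> instr list \<Rightarrow> bool" where
  "code_at prog pc k \<longleftrightarrow> (\<forall>i<length k. pc + i < length prog \<and> prog ! (pc + i) = k ! i)"

lemma code_at_Nil [simp]: "code_at prog pc []"
  by (simp add: code_at_def)

lemma code_at_Cons [simp]:
  "code_at prog pc (i # k) \<longleftrightarrow> pc < length prog \<and> prog ! pc = i \<and> code_at prog (Suc pc) k"
  by (auto simp: code_at_def nth_Cons less_Suc_eq_0_disj split: nat.splits)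

lemma code_at_append [simp]:
  "code_at prog pc (k @ k') \<longleftrightarrow> code_at prog pc k \<and> code_at prog (pc + length k) k'"
  by (induction k arbitrary: pc) auto

text \<open>The bound B applies to addresses and contents alike. The number \<open>4 * N + 3\<close>
  is the address of \<open>Arr True N\<close>; it also exceeds every sum of two values formed before
  saturation.\<close>

locale machine =
  fixes prog :: "instr list" and w :: "bool list" and N B :: nat
  assumes operands: "i \<in> set prog \<Longrightarrow> operand_bound i \<le> B"
    and B: "4 * N + 3 \<le> B" and N: "2 \<le> N"
begin

text \<open>Space is measured in every intermediate configuration, so \<open>fits\<close> is
  recorded along the whole run and not only at its end.\<close>

definition runs :: "config \<Rightarrow> nat \<Rightarrow> config \<Rightarrow> bool" where
  "runs cf m cf' \<longleftrightarrow> (step prog w ^^ m) cf = cf' \<and>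
     (\<forall>i\<le>m. fits B (snd ((step prog w ^^ i) cf)))"

lemma runs_refl: "fits B R \<Longrightarrow> runs (pc, R) 0 (pc, R)"
  by (simp add: runs_def)

lemma runs_trans:
  assumes "runs cf m cf'" "runs cf' m' cf''"
  shows "runs cf (m + m') cf''"
  unfolding runs_def
proof (intro conjI allI impI)
  have it: "(step prog w ^^ (m + i)) cf = (step prog w ^^ i) cf'" for i
    using assms(1) by (simp add: runs_def funpow_add add.commute[of m i])
  show "(step prog w ^^ (m + m')) cf = cf''" using assms(2) it by (simp add: runs_def)
  show "fits B (snd ((step prog w ^^ i) cf))" if "i \<le> m + m'" for i
  proof (cases "i \<le> m")
    case True
    then show ?thesis using assms(1) by (simp add: runs_def)
  next
    case False
    then have "i = m + (i - m)" "i - m \<le> m'" using that by auto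
    then show ?thesis using assms(2) it[of "i - m"] by (auto simp: runs_def)
  qed
qed

lemma runs_step:
  assumes "fits B R" "pc < length prog" "exec_instr w (prog ! pc) (pc, R) = (pc', R')"
    and "runs (pc', R') m cf"
  shows "runs (pc, R) (Suc m) cf"
proof -
  have "step prog w (pc, R) = (pc', R')"
    using assms by (simp add: step_def halted_def)
  moreover have "fits B R'" using assms(4) by (auto simp: runs_def dest: spec[of _ 0])
  ultimately have "runs (pc, R) 1 (pc', R')"
    using assms(1) by (auto simp: runs_def le_Suc_eq)
  from runs_trans[OF this assms(4)] show ?thesis by simp
qed

lemma operand_le: "pc < length prog \<Longrightarrow> operand_bound (prog ! pc) \<le> B"
  by (rule operands) simp

text \<open>In jump-free code only \<open>Add\<close> can leave the range up to B; truncated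
  subtraction, moves, input symbols and constants of the program stay inside.\<close>

fun straight :: "instr list \<Rightarrow> (nat \<Rightarrow> nat) \<Rightarrow> bool" where
  "straight [] R \<longleftrightarrow> True"
| "straight (Jz a t # k) R \<longleftrightarrow> False"
| "straight (Add d a b # k) R \<longleftrightarrow> R a + R b \<le> B \<and> straight k (R(d := R a + R b))"
| "straight (i # k) R \<longleftrightarrow> straight k (snd (exec_instr w i (0, R)))"

definition line :: "instr list \<Rightarrow> (nat \<Rightarrow> nat) \<Rightarrow> (nat \<Rightarrow> nat)" where
  "line k R = fold (\<lambda>i R. snd (exec_instr w i (0, R))) k R"

lemma line_simps [simp]:
  "line [] R = R" "line (i # k) R = line k (snd (exec_instr w i (0, R)))"
  by (simp_all add: line_def)

lemma runs_line:
  assumes "code_at prog pc k" "fits B R" "straight k R"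
  shows "runs (pc, R) (length k) (pc + length k, line k R)"
  using assms
proof (induction k arbitrary: pc R)
  case (Cons i k)
  let ?R = "snd (exec_instr w i (0, R))"
  have pc: "pc < length prog" "prog ! pc = i" "code_at prog (Suc pc) k" using Cons.prems by auto
  have ob: "operand_bound i \<le> B" using operand_le[OF pc(1)] pc(2) by simp
  have R: "R a \<le> B" for a using Cons.prems by (simp add: fits_def)
  have "exec_instr w i (pc, R) = (Suc pc, ?R) \<and> fits B ?R \<and> straight k ?R"
    using Cons.prems ob R B N
    by (cases i) (auto intro!: fits_upd simp: input_symbol_def intro: le_trans[OF diff_le_self])
  then show ?case
    using Cons.IH[OF pc(3), of ?R] pc(1,2) Cons.prems(2)
    by (auto intro: runs_step[of R pc "Suc pc" ?R])
qed (simp add: runs_refl)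

lemma runs_Jz:
  assumes "fits B R" "pc < length prog" "prog ! pc = Jz a t"
    and "runs (if R a = 0 then t else Suc pc, R) m cf"
  shows "runs (pc, R) (Suc m) cf"
  using assms by (intro runs_step[where R' = R]) auto

definition represents :: "(nat \<Rightarrow> nat) \<Rightarrow> store \<Rightarrow> bool" where
  "represents R s \<longleftrightarrow> fits B R \<and> R 1 = N \<and> R 5 = 0 \<and> (\<forall>l. R (addr l) = s l \<and> s l \<le> N)"

lemma represents_fits: "represents R s \<Longrightarrow> fits B R"
  by (simp add: represents_def)

lemma represents_simps:
  assumes "represents R s"
  shows "R (addr l) = s l" "R (Suc 0) = N" "R 5 = 0"
  using assms by (simp_all add: represents_def)

lemma represents_le: "represents R s \<Longrightarrow> s l \<le> N"
  by (simp add: represents_def)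

text \<open>Code at depth d may overwrite the counters from depth d on. A loop compiles its body at
  depth \<open>Suc d\<close>, so its own counter and limit survive the body.\<close>

definition preserves_counters :: "nat \<Rightarrow> (nat \<Rightarrow> nat) \<Rightarrow> (nat \<Rightarrow> nat) \<Rightarrow> bool" where
  "preserves_counters d R R' \<longleftrightarrow>
     (\<forall>e<d. R' (counter e) = R (counter e) \<and> R' (limit e) = R (limit e))"

definition implements :: "com \<Rightarrow> nat \<Rightarrow> nat \<Rightarrow> bool" where
  "implements c d pc \<longleftrightarrow> (\<forall>R s. represents R s \<longrightarrow>
     (\<exists>m R'. m \<le> time N c \<and> runs (pc, R) m (pc + length (code c d pc), R') \<and>
        represents R' (sem w N c s) \<and> preserves_counters d R R'))"

lemma implementsE:
  assumes "implements c d pc" "represents R s"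
  obtains m R' where "m \<le> time N c" "runs (pc, R) m (pc + length (code c d pc), R')"
    "represents R' (sem w N c s)" "preserves_counters d R R'"
  using assms unfolding implements_def by blast

lemma implements_line:
  assumes at: "code_at prog pc (code c d pc)" and time: "time N c = length (code c d pc)"
    and ok: "\<And>R s. represents R s \<Longrightarrow> straight (code c d pc) R \<and>
      (let R' = line (code c d pc) R in
       (\<forall>l. R' (addr l) = sem w N c s l) \<and> R' 1 = N \<and> R' 5 = 0 \<and> preserves_counters d R R')"
  shows "implements c d pc"
  unfolding implements_def
proof (intro allI impI)
  fix R s assume rep: "represents R s"
  let ?R = "line (code c d pc) R"
  have runs: "runs (pc, R) (time N c) (pc + length (code c d pc), ?R)"
    using runs_line[OF at represents_fits[OF rep]] ok[OF rep] time by simp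
  then have "fits B ?R" by (auto simp: runs_def)
  moreover have "sem w N c s l \<le> N" for l
    using rep N by (intro sem_le) (auto simp: represents_def)
  ultimately have "represents ?R (sem w N c s)" using ok[OF rep] by (simp add: represents_def Let_def)
  then show "\<exists>m R'. m \<le> time N c \<and> runs (pc, R) m (pc + length (code c d pc), R') \<and>
        represents R' (sem w N c s) \<and> preserves_counters d R R'"
    using runs ok[OF rep] by (metis order_refl)
qed

lemma quadruple_eq_addr: "i + i + (i + i) + (2 + of_bool a) = addr (Arr a i)"
  "Suc (Suc (i + i + (i + i) + of_bool a)) = addr (Arr a i)"
  by simp_all

lemma code_correct:
  assumes "code_at prog pc (code c d pc)"
  shows "implements c d pc"
  using assms
proof (induction c arbitrary: d pc)
  case Skip
  then show ?case by (intro implements_line) (simp_all add: represents_def preserves_counters_def)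
next
  case (Flag x b)
  then show ?case by (intro implements_line) (auto simp: represents_def preserves_counters_def Let_def)
next
  case (Plus x y z)
  have "s y + s z \<le> B" if "represents R s" for R s
    using represents_le[OF that, of y] represents_le[OF that, of z] B by simp
  then show ?case using Plus
    by (intro implements_line) (auto simp: represents_def preserves_counters_def Let_def)
next
  case (Minus x y z)
  then show ?case by (intro implements_line) (auto simp: represents_def preserves_counters_def Let_def)
next
  case (Input x y)
  then show ?case by (intro implements_line) (auto simp: represents_def preserves_counters_def Let_def)
next
  case (Get a x y)
  have "s y + s y \<le> B \<and> s y + s y + (s y + s y) \<le> B \<and>
      s y + s y + (s y + s y) + (2 + of_bool a) \<le> B" if "represents R s" for R s
    using represents_le[OF that, of y] B by (cases a) simp_all
  then show ?case using Get
    by (intro implements_line)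
      (auto simp: represents_def preserves_counters_def Let_def quadruple_eq_addr simp del: addr.simps)
next
  case (Put a x y)
  have "s x + s x \<le> B \<and> s x + s x + (s x + s x) \<le> B \<and>
      s x + s x + (s x + s x) + (2 + of_bool a) \<le> B" if "represents R s" for R s
    using represents_le[OF that, of x] B by (cases a) simp_all
  then show ?case using Put
    by (intro implements_line)
      (auto simp: represents_def preserves_counters_def Let_def quadruple_eq_addr simp del: addr.simps)
next
  case (Seq c1 c2)
  let ?pc = "pc + length (code c1 d pc)"
  have at: "code_at prog pc (code c1 d pc)" "code_at prog ?pc (code c2 d ?pc)"
    using Seq.prems by simp_all
  show ?case unfolding implements_def
  proof (intro allI impI)
    fix R s assume "represents R s"
    from implementsE[OF Seq.IH(1)[OF at(1)] this] obtain m1 R1 where 1: "m1 \<le> time N c1"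
      "runs (pc, R) m1 (?pc, R1)" "represents R1 (sem w N c1 s)" "preserves_counters d R R1" .
    from implementsE[OF Seq.IH(2)[OF at(2)] 1(3)] obtain m2 R2 where 2: "m2 \<le> time N c2"
      "runs (?pc, R1) m2 (?pc + length (code c2 d ?pc), R2)"
      "represents R2 (sem w N c2 (sem w N c1 s))" "preserves_counters d R1 R2" .
    show "\<exists>m R'. m \<le> time N (c1 ;; c2) \<and>
        runs (pc, R) m (pc + length (code (c1 ;; c2) d pc), R') \<and>
        represents R' (sem w N (c1 ;; c2) s) \<and> preserves_counters d R R'"
      using 1 2 runs_trans[OF 1(2) 2(2)]
      by (intro exI[of _ "m1 + m2"] exI[of _ R2]) (simp add: preserves_counters_def add.assoc)
  qed
next
  case (Cond x c1 c2)
  define k1 where "k1 = code c1 d (Suc pc)"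
  define pc2 where "pc2 = pc + 2 + length k1"
  define k2 where "k2 = code c2 d pc2"
  have code: "code (Cond x c1 c2) d pc = Jz (addr x) pc2 # k1 @ Jz 5 (pc2 + length k2) # k2"
    by (simp add: k1_def pc2_def k2_def Let_def)
  have len: "pc + length (code (Cond x c1 c2) d pc) = pc2 + length k2"
    unfolding code by (simp add: pc2_def)
  have at: "code_at prog (Suc pc) (code c1 d (Suc pc))" "code_at prog pc2 (code c2 d pc2)"
    and jz: "pc < length prog" "prog ! pc = Jz (addr x) pc2"
      "Suc pc + length k1 < length prog" "prog ! (Suc pc + length k1) = Jz 5 (pc2 + length k2)"
    using Cond.prems[unfolded code]
    by (simp_all add: k1_def[symmetric] k2_def[symmetric]) (simp_all add: pc2_def)
  show ?case unfolding implements_def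
  proof (intro allI impI)
    fix R s assume rep: "represents R s"
    have "\<exists>m R'. m \<le> time N c1 + time N c2 + 2 \<and> runs (pc, R) m (pc2 + length k2, R') \<and>
        represents R' (sem w N (Cond x c1 c2) s) \<and> preserves_counters d R R'"
    proof (cases "s x = 0")
      case True
      from implementsE[OF Cond.IH(2)[OF at(2)] rep] obtain m R' where "m \<le> time N c2"
        "runs (pc2, R) m (pc2 + length k2, R')" "represents R' (sem w N c2 s)"
        "preserves_counters d R R'" unfolding k2_def .
      moreover have "R (addr x) = 0" using rep True by (simp add: represents_def)
      ultimately show ?thesis using True
        by (intro exI[of _ "Suc m"] exI[of _ R']) (auto intro!: runs_Jz[OF represents_fits[OF rep] jz(1,2)])
    next
      case False
      from implementsE[OF Cond.IH(1)[OF at(1)] rep] obtain m R' where 1: "m \<le> time N c1"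
        "runs (Suc pc, R) m (Suc pc + length k1, R')" "represents R' (sem w N c1 s)"
        "preserves_counters d R R'" unfolding k1_def .
      have "R (addr x) \<noteq> 0" using rep False by (simp add: represents_def)
      then have "runs (pc, R) (Suc m) (Suc pc + length k1, R')"
        using 1 by (intro runs_Jz[OF represents_fits[OF rep] jz(1,2)]) simp
      moreover have "runs (Suc pc + length k1, R') (Suc 0) (pc2 + length k2, R')"
        using represents_fits[OF 1(3)] represents_simps(3)[OF 1(3)]
        by (intro runs_Jz[OF _ jz(3,4)]) (auto intro: runs_refl)
      ultimately have "runs (pc, R) (Suc m + Suc 0) (pc2 + length k2, R')" by (rule runs_trans)
      then show ?thesis using 1 False
        by (intro exI[of _ "Suc m + Suc 0"] exI[of _ R']) simp
    qed
    then show "\<exists>m R'. m \<le> time N (Cond x c1 c2) \<and>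
        runs (pc, R) m (pc + length (code (Cond x c1 c2) d pc), R') \<and>
        represents R' (sem w N (Cond x c1 c2) s) \<and> preserves_counters d R R'"
      by (simp only: len time.simps)
  qed
next
  case (Loop x y c)
  define k where "k = code c (Suc d) (pc + 5)"
  define fin where "fin = pc + 8 + length k"
  have code: "code (Loop x y c) d pc =
     [Const (counter d) 0, Add (limit d) (addr y) 5] @ [Sub 9 (limit d) (counter d)] @
      Jz 9 fin # [Add (addr x) (counter d) 5] @ k @
     [Const 9 1, Add (counter d) (counter d) 9] @ [Jz 5 (pc + 2)]"
    by (simp add: k_def fin_def Let_def)
  have at: "code_at prog pc [Const (counter d) 0, Add (limit d) (addr y) 5]"
      "code_at prog (pc + 2) [Sub 9 (limit d) (counter d)]"
      "code_at prog (pc + 4) [Add (addr x) (counter d) 5]"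
      "code_at prog (pc + 5) k"
      "code_at prog (pc + 5 + length k) [Const 9 1, Add (counter d) (counter d) 9]"
    and jz: "pc + 3 < length prog" "prog ! (pc + 3) = Jz 9 fin"
      "pc + 7 + length k < length prog" "prog ! (pc + 7 + length k) = Jz 5 (pc + 2)"
    using Loop.prems[unfolded code]
    by (simp_all add: eval_nat_numeral)
  have Suc_pc: "Suc (Suc (Suc pc)) = pc + 3" "Suc (pc + 3) = pc + 4" "Suc (pc + 4) = pc + 5"
    "Suc (Suc (pc + 5 + length k)) = pc + 7 + length k" by simp_all
  let ?body = "\<lambda>i s. sem w N c (s(x := i))"
  \<comment> \<open>Here j is the number of iterations left, so the counter holds
    \<open>L - j\<close>. The summand 2 pays for the final test, and each iteration adds six steps
    to its body.\<close>
  have iter: "\<exists>m R'. m \<le> 2 + j * (time N c + 6) \<and> runs (pc + 2, R) m (fin, R') \<and>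
      represents R' (fold ?body [L - j..<L] s) \<and> preserves_counters d R R'"
    if "represents R s" "R (counter d) = L - j" "R (limit d) = L" "j \<le> L" "L \<le> N" for R s L j
    using that
  proof (induction j arbitrary: R s)
    case 0
    let ?R = "R(9 := 0)"
    have "runs (pc + 2, R) 1 (pc + 3, ?R)"
      using runs_line[OF at(2) represents_fits[OF 0(1)]] 0 by (simp add: Suc_pc)
    moreover have fits: "fits B ?R" using calculation by (auto simp: runs_def)
    then have "runs (pc + 3, ?R) (Suc 0) (fin, ?R)"
      by (intro runs_Jz[OF _ jz(1,2)]) (auto intro: runs_refl)
    ultimately have "runs (pc + 2, R) (1 + Suc 0) (fin, ?R)" by (rule runs_trans)
    moreover have "represents ?R (fold ?body [L - 0..<L] s)" "preserves_counters d R ?R"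
      using 0 fits by (simp_all add: represents_def preserves_counters_def)
    moreover have "1 + Suc 0 \<le> 2 + 0 * (time N c + 6)" by simp
    ultimately show ?case by blast
  next
    case (Suc j)
    let ?i = "L - Suc j"
    let ?R1 = "R(9 := Suc j)" and ?R2 = "R(9 := Suc j, addr x := ?i)"
    have "runs (pc + 2, R) 1 (pc + 3, ?R1)"
      using runs_line[OF at(2) represents_fits[OF Suc.prems(1)]] Suc.prems by (simp add: Suc_pc)
    moreover have fits1: "fits B ?R1" using calculation by (auto simp: runs_def)
    have "runs (pc + 4, ?R1) 1 (pc + 5, ?R2)"
      using runs_line[OF at(3) fits1] Suc.prems represents_simps(3)[OF Suc.prems(1)] B
      by (simp add: Suc_pc)
    then have "runs (pc + 3, ?R1) (Suc 1) (pc + 5, ?R2)"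
      using fits1 by (intro runs_Jz[OF _ jz(1,2)]) (auto simp: Suc_pc)
    ultimately have r1: "runs (pc + 2, R) (1 + Suc 1) (pc + 5, ?R2)" by (rule runs_trans)
    have rep2: "represents ?R2 (s(x := ?i))"
      using Suc.prems r1 by (auto simp: represents_def runs_def)
    from implementsE[OF Loop.IH[OF at(4)[unfolded k_def]] rep2] obtain m R3 where 3: "m \<le> time N c"
      "runs (pc + 5, ?R2) m (pc + 5 + length k, R3)" "represents R3 (?body ?i s)"
      "preserves_counters (Suc d) ?R2 R3" unfolding k_def .
    have c3: "R3 (counter d) = ?i" "R3 (limit d) = L"
      using 3(4) Suc.prems by (auto simp: preserves_counters_def)
    let ?R4 = "R3(9 := 1, counter d := L - j)"
    have "Suc (L - Suc j) = L - j" "L - j \<le> B" using Suc.prems B by simp_all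
    then have r4: "runs (pc + 5 + length k, R3) 2 (pc + 7 + length k, ?R4)"
      using runs_line[OF at(5) represents_fits[OF 3(3)]] c3 B Suc.prems
      by (simp add: numeral_2_eq_2 ac_simps)
    then have fits4: "fits B ?R4" by (auto simp: runs_def)
    have rep4: "represents ?R4 (?body ?i s)" using 3(3) fits4 by (auto simp: represents_def)
    have j5: "runs (pc + 7 + length k, ?R4) (Suc 0) (pc + 2, ?R4)"
      using fits4 represents_simps(3)[OF rep4]
      by (intro runs_Jz[OF _ jz(3,4)]) (auto intro: runs_refl)
    have "\<exists>m R'. m \<le> 2 + j * (time N c + 6) \<and> runs (pc + 2, ?R4) m (fin, R') \<and>
      represents R' (fold ?body [L - j..<L] (?body ?i s)) \<and> preserves_counters d ?R4 R'"
      using Suc.prems c3 by (intro Suc.IH[OF rep4]) auto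
    then obtain m' R' where 5: "m' \<le> 2 + j * (time N c + 6)" "runs (pc + 2, ?R4) m' (fin, R')"
      "represents R' (fold ?body [L - j..<L] (?body ?i s))" "preserves_counters d ?R4 R'" by blast
    have "[?i..<L] = ?i # [L - j..<L]"
      using Suc.prems by (simp add: upt_conv_Cons \<open>Suc (L - Suc j) = L - j\<close>)
    then have "represents R' (fold ?body [?i..<L] s)" using 5(3) by simp
    moreover have "preserves_counters d R R'"
      using 3(4) 5(4) by (auto simp: preserves_counters_def)
    moreover have "runs (pc + 2, R) ((((1 + Suc 1) + m) + 2) + Suc 0 + m') (fin, R')"
      by (rule runs_trans[OF runs_trans[OF runs_trans[OF runs_trans[OF r1 3(2)] r4] j5] 5(2)])
    moreover have "(((1 + Suc 1) + m) + 2) + Suc 0 + m' \<le> 2 + Suc j * (time N c + 6)"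
      using 3(1) 5(1) by simp
    ultimately show ?case by blast
  qed
  show ?case unfolding implements_def
  proof (intro allI impI)
    fix R s assume rep: "represents R s"
    let ?R1 = "R(counter d := 0, limit d := s y)"
    have sy: "s y \<le> N" "s y \<le> B" using represents_le[OF rep, of y] B by simp_all
    have r1: "runs (pc, R) 2 (pc + 2, ?R1)"
      using runs_line[OF at(1) represents_fits[OF rep]] rep sy
      by (simp add: represents_def numeral_2_eq_2)
    then have "fits B ?R1" by (auto simp: runs_def)
    then have "represents ?R1 s" using rep by (simp add: represents_def)
    from iter[OF this, of "s y" "s y"] sy obtain m R' where
      2: "m \<le> 2 + s y * (time N c + 6)" "runs (pc + 2, ?R1) m (fin, R')"
      "represents R' (fold ?body [0..<s y] s)" "preserves_counters d ?R1 R'" by auto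
    have "s y * (time N c + 6) \<le> N * (time N c + 6)" using sy(1) by (rule mult_le_mono1)
    then have "2 + m \<le> time N (Loop x y c)" using 2(1) unfolding time.simps by linarith
    then show "\<exists>m R'. m \<le> time N (Loop x y c) \<and>
        runs (pc, R) m (pc + length (code (Loop x y c) d pc), R') \<and>
        represents R' (sem w N (Loop x y c) s) \<and> preserves_counters d R R'"
      unfolding code using runs_trans[OF r1 2(2)] 2
      by (intro exI[of _ "2 + m"] exI[of _ R'])
        (auto simp: fin_def add.commute preserves_counters_def eval_nat_numeral)
  qed
qed

end

section \<open>Polynomial bounds\<close>

text \<open>The base \<open>Suc n\<close> is at least 1 and the bound holds for all n. Powers are
  then monotone in the exponent, and the closure properties become simplification rules.\<close>

definition poly_growth :: "(nat \<Rightarrow> nat) \<Rightarrow> bool" where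
  "poly_growth f \<longleftrightarrow> (\<exists>c d. \<forall>n. f n \<le> c * Suc n ^ d)"

lemma poly_growth_const [simp]: "poly_growth (\<lambda>_. c)"
  unfolding poly_growth_def by (intro exI[of _ c] exI[of _ 0]) simp

lemma poly_growth_id [simp]: "poly_growth (\<lambda>n. n)"
  unfolding poly_growth_def by (intro exI[of _ 1]) simp

lemma poly_growth_add [simp]:
  assumes "poly_growth f" "poly_growth g"
  shows "poly_growth (\<lambda>n. f n + g n)"
proof -
  obtain c d c' d' where "\<And>n. f n \<le> c * Suc n ^ d" "\<And>n. g n \<le> c' * Suc n ^ d'"
    using assms by (auto simp: poly_growth_def)
  moreover have "Suc n ^ d \<le> Suc n ^ (d + d')" "Suc n ^ d' \<le> Suc n ^ (d + d')" for n
    by (intro power_increasing; simp)+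
  ultimately have "f n + g n \<le> c * Suc n ^ (d + d') + c' * Suc n ^ (d + d')" for n
    by (meson add_mono le_trans mult_le_mono2)
  then have "f n + g n \<le> (c + c') * Suc n ^ (d + d')" for n
    by (simp only: distrib_right)
  then show ?thesis unfolding poly_growth_def by blast
qed

lemma poly_growth_mult [simp]:
  assumes "poly_growth f" "poly_growth g"
  shows "poly_growth (\<lambda>n. f n * g n)"
proof -
  obtain c d c' d' where "\<And>n. f n \<le> c * Suc n ^ d" "\<And>n. g n \<le> c' * Suc n ^ d'"
    using assms by (auto simp: poly_growth_def)
  then have "f n * g n \<le> (c * Suc n ^ d) * (c' * Suc n ^ d')" for n by (intro mult_le_mono)
  then have "f n * g n \<le> (c * c') * Suc n ^ (d + d')" for n
    by (simp only: power_add mult_ac)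
  then show ?thesis unfolding poly_growth_def by blast
qed

lemma poly_growth_Suc [simp]: "poly_growth f \<Longrightarrow> poly_growth (\<lambda>n. Suc (f n))"
  using poly_growth_add[of f "\<lambda>_. 1"] by simp

lemma poly_growth_poly_bounded:
  assumes "poly_growth f"
  shows "poly_bounded f"
proof -
  obtain c d where f: "\<And>n. f n \<le> c * Suc n ^ d" using assms by (auto simp: poly_growth_def)
  \<comment> \<open>The factor \<open>2 ^ d\<close> comes from \<open>Suc n <= 2 * n\<close> for
    positive n.\<close>
  have "real (f n) \<le> real (c * 2 ^ d) * norm (real n ^ d)" if "1 \<le> n" for n
  proof -
    have "f n \<le> c * (2 * n) ^ d"
      using that by (intro le_trans[OF f] mult_le_mono2 power_mono) auto
    then have "real (f n) \<le> real (c * (2 * n) ^ d)" by (rule of_nat_mono)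
    then show ?thesis by (simp add: power_mult_distrib)
  qed
  then have "(\<lambda>n. real (f n)) \<in> O(\<lambda>n. real n ^ d)"
    by (intro bigoI[where c = "real (c * 2 ^ d)"] eventually_sequentiallyI[of 1]) auto
  then show ?thesis unfolding poly_bounded_def by blast
qed

text \<open>The command is fixed, so its loops multiply by N only a fixed number of times.\<close>

lemma poly_growth_time: "poly_growth f \<Longrightarrow> poly_growth (\<lambda>n. time (f n) c)"
  by (induction c) simp_all


section \<open>Resources of complete programs\<close>

text \<open>This crude estimate suffices because B is itself polynomial in n.\<close>

lemma bit_length_le: "bit_length m \<le> Suc m"
proof -
  have "floor_log m \<le> m"
  proof (cases "m = 0")
    case False
    then have "2 ^ floor_log m \<le> m" by (intro floor_log_exp2_le) simp
    then show ?thesis using less_exp[of "floor_log m"] by linarith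
  qed simp
  then show ?thesis by (simp add: bit_length_def)
qed

lemma bit_length_le_trans: "m \<le> B \<Longrightarrow> bit_length m \<le> Suc B"
  using bit_length_le[of m] by simp

lemma config_space_le:
  assumes "fits B (snd cf)"
  shows "config_space cf \<le> 2 * Suc B * Suc B"
proof -
  have "{a. snd cf a \<noteq> 0} \<subseteq> {..B}" using assms by (auto simp: fits_def not_less[symmetric])
  then have "config_space cf \<le> (\<Sum>a\<in>{..B}. bit_length a + bit_length (snd cf a))"
    unfolding config_space_def by (intro sum_mono2) auto
  also have "\<dots> \<le> (\<Sum>a\<in>{..B}. 2 * Suc B)"
  proof (rule sum_mono)
    fix a assume "a \<in> {..B}"
    moreover have "snd cf a \<le> B" using assms by (simp add: fits_def)
    ultimately have "bit_length a \<le> Suc B" "bit_length (snd cf a) \<le> Suc B"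
      by (simp_all only: bit_length_le_trans atMost_iff)
    then show "bit_length a + bit_length (snd cf a) \<le> 2 * Suc B" by simp
  qed
  finally show ?thesis by simp
qed

lemma instr_cost_le:
  assumes "fits B R" "operand_bound i \<le> B"
  shows "instr_cost i R \<le> 5 * Suc B"
proof -
  have R: "bit_length (R a) \<le> Suc B" for a
    using assms(1) by (intro bit_length_le_trans) (simp add: fits_def)
  note ob = bit_length_le_trans[of _ B]
  show ?thesis
  proof (cases i)
    case (Const d c)
    then show ?thesis using ob[of d] ob[of c] assms(2) by simp
  next
    case (Add d a b)
    then show ?thesis using ob[of d] ob[of a] ob[of b] R[of a] R[of b] assms(2) by simp
  next
    case (Sub d a b)
    then show ?thesis using ob[of d] ob[of a] ob[of b] R[of a] R[of b] assms(2) by simp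
  next
    case (Load d a)
    then show ?thesis using ob[of d] ob[of a] R[of a] R[of "R a"] assms(2) by simp
  next
    case (Store d a)
    then show ?thesis using ob[of d] ob[of a] R[of d] R[of a] assms(2) by simp
  next
    case (Read d a)
    then show ?thesis using ob[of d] ob[of a] R[of a] assms(2) by simp
  next
    case (Jz a t)
    then show ?thesis using ob[of a] R[of a] assms(2) by simp
  qed
qed

text \<open>Register 16, the address of \<open>V 2\<close>, counts the leading ones of the input.
  Register 1 follows with \<open>bound j\<close>, starting from \<open>bound 0 = 10\<close>; lacking
  multiplication, it grows by the difference \<open>2 * j + 6\<close>.\<close>

definition count_vertices :: "instr list" where
  "count_vertices =
    [Const 1 10, Read 9 16, Jz 9 10, Add 1 1 16, Add 1 1 16, Const 9 6, Add 1 1 9,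
     Const 9 1, Add 16 16 9, Jz 5 1]"

text \<open>The largest input position to be read is \<open>cell_pos n (Suc n) (Suc n)\<close>,
  which is \<open>n * n + 3 * n + 2\<close>. It stays below the bound, so no input address is
  falsified by saturation.\<close>

definition bound :: "nat \<Rightarrow> nat" where "bound n = n * n + 5 * n + 10"

text \<open>The jump back to \<open>pc1\<close> closes a loop around \<open>c2\<close> that ends
  when \<open>x\<close> becomes nonzero; its number of rounds may be exponential.\<close>

definition complete_program :: "com \<Rightarrow> com \<Rightarrow> loc \<Rightarrow> com \<Rightarrow> instr list" where
  "complete_program c1 c2 x c3 =
    (let k1 = code c1 0 10; pc1 = 10 + length k1; k2 = code c2 0 pc1 in
     count_vertices @ k1 @ k2 @ [Jz (addr x) pc1] @ code c3 0 (Suc (pc1 + length k2)))"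

context machine
begin

text \<open>One initial instruction, nine for each leading one, and two for the zero that ends the
  count.\<close>

lemma runs_count_vertices:
  assumes at: "code_at prog 0 count_vertices" and Nn: "N = bound n"
    and ones: "\<And>i. i < n \<Longrightarrow> input_symbol w i = 1" and zero: "input_symbol w n = 0"
  obtains R where "runs (0, \<lambda>_. 0) (9 * n + 3) (10, R)" "represents R ((\<lambda>_. 0)(V 2 := n))"
proof -
  have mono: "bound j \<le> N" if "j \<le> n" for j
    using that mult_le_mono[OF that that] by (simp add: Nn bound_def)
  have at': "code_at prog 0 [Const 1 10]" "code_at prog 1 [Read 9 16]"
      "code_at prog 3 [Add 1 1 16, Add 1 1 16, Const 9 6, Add 1 1 9, Const 9 1, Add 16 16 9]"
    and jz: "2 < length prog" "prog ! 2 = Jz 9 10" "9 < length prog" "prog ! 9 = Jz 5 1"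
    using at unfolding count_vertices_def by (simp_all add: eval_nat_numeral)
  have read: "runs (1, R) 2 (if input_symbol w j = 0 then 10 else 3, R(9 := input_symbol w j))"
    if "fits B R" "R 16 = j" for R j
  proof -
    have "runs (1, R) 1 (2, R(9 := input_symbol w j))"
      using runs_line[OF at'(2) that(1)] that by (simp add: numeral_2_eq_2)
    moreover from this have "fits B (R(9 := input_symbol w j))" by (auto simp: runs_def)
    then have "runs (2, R(9 := input_symbol w j)) (Suc 0)
        (if input_symbol w j = 0 then 10 else 3, R(9 := input_symbol w j))"
      by (intro runs_Jz[OF _ jz(1,2)]) (auto intro: runs_refl)
    ultimately have "runs (1, R) (1 + Suc 0)
        (if input_symbol w j = 0 then 10 else 3, R(9 := input_symbol w j))" by (rule runs_trans)
    then show ?thesis by (simp only: add_Suc add_0 One_nat_def numeral_2_eq_2)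
  qed
  have "\<exists>R. runs (0, \<lambda>_. 0) (9 * j + 1) (1, R) \<and> R 1 = bound j \<and> R 16 = j \<and>
      (\<forall>a. a \<notin> {1, 16, 9} \<longrightarrow> R a = 0)" if "j \<le> n" for j
    using that
  proof (induction j)
    case 0
    have "fits B (\<lambda>_. 0)" by (simp add: fits_def)
    from runs_line[OF at'(1) this] show ?case by (auto simp: bound_def intro: exI)
  next
    case (Suc j)
    then obtain R where R: "runs (0, \<lambda>_. 0) (9 * j + 1) (1, R)" "R 1 = bound j" "R 16 = j"
      "\<And>a. a \<notin> {1, 16, 9} \<Longrightarrow> R a = 0" by auto
    have "fits B R" using R(1) by (auto simp: runs_def)
    from read[OF this R(3)] ones[of j] Suc.prems
    have r1: "runs (1, R) 2 (3, R(9 := 1))" by simp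
    then have fits: "fits B (R(9 := 1))" by (auto simp: runs_def)
    let ?R = "R(1 := bound (Suc j), 16 := Suc j, 9 := 1)"
    have b: "bound (Suc j) = bound j + j + j + 6" by (simp add: bound_def)
    have "bound j + j + j + 6 \<le> B" "j + 1 \<le> B" using mono[OF Suc.prems] B Suc.prems unfolding b by simp_all
    then have r2: "runs (3, R(9 := 1)) (Suc (Suc (Suc (Suc (Suc (Suc 0)))))) (9, ?R)"
      using runs_line[OF at'(3) fits] R(2,3) by (simp add: b fun_upd_twist)
    then have "fits B ?R" by (auto simp: runs_def)
    then have "runs (9, ?R) (Suc 0) (1, ?R)"
      using R(4)[of 5] by (intro runs_Jz[OF _ jz(3,4)]) (auto intro: runs_refl)
    note runs_trans[OF runs_trans[OF runs_trans[OF R(1) r1] r2] this]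
    moreover have "9 * j + 1 + 2 + Suc (Suc (Suc (Suc (Suc (Suc 0))))) + Suc 0 = 9 * Suc j + 1"
      by simp
    ultimately have "runs (0, \<lambda>_. 0) (9 * Suc j + 1) (1, ?R)" by (simp only:)
    moreover have "?R 1 = bound (Suc j) \<and> ?R 16 = Suc j \<and> (\<forall>a. a \<notin> {1, 16, 9} \<longrightarrow> ?R a = 0)"
      using R(4) by simp
    ultimately show ?case by blast
  qed
  from this[of n] obtain R where R: "runs (0, \<lambda>_. 0) (9 * n + 1) (1, R)" "R 1 = bound n" "R 16 = n"
      "\<And>a. a \<notin> {1, 16, 9} \<Longrightarrow> R a = 0" by auto
  have "fits B R" using R(1) by (auto simp: runs_def)
  from read[OF this R(3)] zero have "runs (1, R) 2 (10, R(9 := 0))" by simp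
  from runs_trans[OF R(1) this] have r: "runs (0, \<lambda>_. 0) (9 * n + 3) (10, R(9 := 0))"
    by (simp add: numeral_3_eq_3)
  then have "fits B (R(9 := 0))" by (auto simp: runs_def)
  moreover have "R (addr l) = ((\<lambda>_. 0)(V 2 := n)) l" for l
  proof (cases "l = V 2")
    case False
    then have "addr l \<noteq> addr (V 2)" by (simp del: addr.simps)
    then have "addr l \<noteq> 16" by simp
    then show ?thesis using R(4)[of "addr l"] False by simp
  qed (use R(3) in simp)
  moreover have "((\<lambda>_. 0)(V 2 := n)) l \<le> N" for l by (simp add: Nn bound_def)
  ultimately have "represents (R(9 := 0)) ((\<lambda>_. 0)(V 2 := n))"
    using R(2,4) Nn unfolding represents_def by simp
  then show thesis using that r by blast
qed

text \<open>The flag is tested after the body, so M counts passes from 1 and the value of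
  \<open>x\<close> before the first pass is left open. Each pass costs one extra step for the
  jump.\<close>

lemma runs_complete_program:
  assumes prog: "prog = complete_program c1 c2 x c3" and Nn: "N = bound n"
    and ones: "\<And>i. i < n \<Longrightarrow> input_symbol w i = 1" and zero: "input_symbol w n = 0"
    and st: "st = (\<lambda>j. (sem w N c2 ^^ j) (sem w N c1 ((\<lambda>_. 0)(V 2 := n))))"
    and M: "0 < M" "st M x \<noteq> 0" "\<And>j. 0 < j \<Longrightarrow> j < M \<Longrightarrow> st j x = 0"
  obtains m R where
    "m \<le> 9 * n + 3 + time N c1 + M * (time N c2 + 1) + time N c3"
    "runs (0, \<lambda>_. 0) m (length prog, R)" "represents R (sem w N c3 (st M))"
proof -
  define k1 where "k1 = code c1 0 10"
  define pc1 where "pc1 = 10 + length k1"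
  define k2 where "k2 = code c2 0 pc1"
  define pc3 where "pc3 = Suc (pc1 + length k2)"
  have prog': "prog = count_vertices @ k1 @ k2 @ [Jz (addr x) pc1] @ code c3 0 pc3"
    unfolding prog complete_program_def
    by (simp add: k1_def pc1_def k2_def pc3_def Let_def)
  have len: "length count_vertices = 10" by (simp add: count_vertices_def)
  have "code_at prog 0 prog" by (simp add: code_at_def)
  then have at: "code_at prog 0 count_vertices" "code_at prog 10 k1" "code_at prog pc1 k2"
      "code_at prog pc3 (code c3 0 pc3)"
    and jz: "pc1 + length k2 < length prog" "prog ! (pc1 + length k2) = Jz (addr x) pc1"
    by (subst (asm) (2) prog', simp add: len pc1_def pc3_def add.assoc)+
  have length: "length prog = pc3 + length (code c3 0 pc3)"
    by (subst prog') (simp add: len pc1_def pc3_def)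
  obtain R0 where R0: "runs (0, \<lambda>_. 0) (9 * n + 3) (10, R0)" "represents R0 ((\<lambda>_. 0)(V 2 := n))"
    by (rule runs_count_vertices[OF at(1) Nn ones zero])
  from implementsE[OF code_correct[OF at(2)[unfolded k1_def]] R0(2)]
  obtain m1 R1 where 1: "m1 \<le> time N c1" "runs (10, R0) m1 (pc1, R1)" "represents R1 (st 0)"
    by (simp add: st pc1_def k1_def) blast
  have iter: "\<exists>m R. m \<le> j * (time N c2 + 1) \<and> runs (pc1, R1) m (if j = M then pc3 else pc1, R) \<and>
      represents R (st j)" if "j \<le> M" for j
    using that
  proof (induction j)
    case 0
    then show ?case using 1(3) M(1) runs_refl[OF represents_fits[OF 1(3)]] by force
  next
    case (Suc j)
    then obtain m R where R: "m \<le> j * (time N c2 + 1)" "runs (pc1, R1) m (pc1, R)" "represents R (st j)"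
      by auto
    from implementsE[OF code_correct[OF at(3)[unfolded k2_def]] R(3)]
    obtain m' R' where R': "m' \<le> time N c2" "runs (pc1, R) m' (pc1 + length k2, R')"
      "represents R' (st (Suc j))" by (simp add: st k2_def) blast
    have "st (Suc j) x = 0 \<longleftrightarrow> Suc j \<noteq> M" using M Suc.prems by (cases "Suc j = M") auto
    then have "runs (pc1 + length k2, R') (Suc 0) (if Suc j = M then pc3 else pc1, R')"
      using represents_simps(1)[OF R'(3)] represents_fits[OF R'(3)]
      by (intro runs_Jz[OF _ jz]) (auto simp: pc3_def intro: runs_refl)
    from runs_trans[OF runs_trans[OF R(2) R'(2)] this] show ?case
      using R(1) R'(1,3) by (intro exI[of _ "m + m' + Suc 0"] exI[of _ R']) auto
  qed
  from iter[of M] obtain m2 R2 where 2: "m2 \<le> M * (time N c2 + 1)" "runs (pc1, R1) m2 (pc3, R2)"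
      "represents R2 (st M)" by auto
  from implementsE[OF code_correct[OF at(4)] 2(3)]
  obtain m3 R3 where 3: "m3 \<le> time N c3" "runs (pc3, R2) m3 (length prog, R3)"
    "represents R3 (sem w N c3 (st M))" by (metis length)
  have "9 * n + 3 + m1 + m2 + m3 \<le> 9 * n + 3 + time N c1 + M * (time N c2 + 1) + time N c3"
    using 1(1) 2(1) 3(1) by linarith
  then show thesis
    using that runs_trans[OF runs_trans[OF runs_trans[OF R0(1) 1(2)] 2(2)] 3(2)] 3(3) by blast
qed

lemma decides_within_if_runs:
  assumes "runs (0, \<lambda>_. 0) m (length prog, R)" "R 0 = of_bool ans"
  shows "decides_within prog w ans (m * (5 * Suc B)) (2 * Suc B * Suc B)"
proof -
  have final: "config_after prog w m = (length prog, R)"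
    and fits: "\<And>i. i \<le> m \<Longrightarrow> fits B (snd (config_after prog w i))"
    using assms(1) by (auto simp: runs_def config_after_def)
  have "step_cost prog (config_after prog w i) \<le> 5 * Suc B" if "i < m" for i
  proof (cases "halted prog (config_after prog w i)")
    case False
    then have "operand_bound (prog ! fst (config_after prog w i)) \<le> B"
      by (intro operand_le) (simp add: halted_def)
    then show ?thesis using instr_cost_le[OF fits[of i]] that False by (simp add: step_cost_def)
  qed (simp add: step_cost_def)
  then have "(\<Sum>i<m. step_cost prog (config_after prog w i)) \<le> m * (5 * Suc B)"
    using sum_bounded_above[of "{..<m}" _ "5 * Suc B"] by simp
  then show ?thesis
    unfolding decides_within_def using final assms(2) config_space_le[OF fits]
    by (intro exI[of _ m]) (auto simp: halted_def)
qed

end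

section \<open>Evaluating formulas\<close>

text \<open>
  \<open>Cell x y\<close> reads the input as a table with n columns that starts behind the unary length: its
  rows are the adjacency matrix, the characteristic vector of X, and the digits of p.
  Quantifiers range over the vertices; the one at level q binds the variable \<open>V q\<close>. The number
  of vertices is kept in \<open>V 2\<close>, and results are delivered in \<open>T q\<close>.
\<close>

datatype fm =
    Cell nat nat
  | Mem bool nat
  | Neq nat nat
  | Nonzero nat
  | Neg fm
  | Conj fm fm
  | Forall fm

text \<open>The offset \<open>n + 1\<close> skips the unary length and its terminator. The digits of
  p are the last row and may run on beyond column n.\<close>

definition cell_pos :: "nat \<Rightarrow> nat \<Rightarrow> nat \<Rightarrow> nat" where
  "cell_pos n i j = n + 1 + i * n + j"

primrec eval :: "bool list \<Rightarrow> nat \<Rightarrow> nat \<Rightarrow> fm \<Rightarrow> store \<Rightarrow> bool" where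
  "eval w N q (Cell x y) s \<longleftrightarrow>
     input_symbol w (min N (cell_pos (s (V 2)) (s (V x)) (s (V y)))) \<noteq> 0"
| "eval w N q (Mem a x) s \<longleftrightarrow> s (Arr a (s (V x))) \<noteq> 0"
| "eval w N q (Neq x y) s \<longleftrightarrow> s (V x) \<noteq> s (V y)"
| "eval w N q (Nonzero x) s \<longleftrightarrow> s (V x) \<noteq> 0"
| "eval w N q (Neg f) s \<longleftrightarrow> \<not> eval w N q f s"
| "eval w N q (Conj f g) s \<longleftrightarrow> eval w N q f s \<and> eval w N q g s"
| "eval w N q (Forall f) s \<longleftrightarrow> (\<forall>i<s (V 2). eval w N (Suc q) f (s(V q := i)))"

primrec wf_fm :: "nat \<Rightarrow> fm \<Rightarrow> bool" where
  "wf_fm q (Cell x y) \<longleftrightarrow> x < q \<and> y < q"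
| "wf_fm q (Mem a x) \<longleftrightarrow> x < q"
| "wf_fm q (Neq x y) \<longleftrightarrow> x < q \<and> y < q"
| "wf_fm q (Nonzero x) \<longleftrightarrow> x < q"
| "wf_fm q (Neg f) \<longleftrightarrow> wf_fm q f"
| "wf_fm q (Conj f g) \<longleftrightarrow> wf_fm q f \<and> wf_fm q g"
| "wf_fm q (Forall f) \<longleftrightarrow> wf_fm (Suc q) f"

text \<open>The row offset is a product and has to be accumulated by repeated addition. The initial
  1 accounts for the terminator of the unary length.\<close>

definition read_cell :: "nat \<Rightarrow> nat \<Rightarrow> nat \<Rightarrow> com" where
  "read_cell q x y =
     Flag (T q) True ;;
     Loop (T (Suc q)) (V x) (Plus (T q) (T q) (V 2)) ;;
     Plus (T q) (T q) (V 2) ;;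
     Plus (T q) (T q) (V y) ;;
     Input (T q) (T q)"

primrec compute :: "nat \<Rightarrow> fm \<Rightarrow> com" where
  "compute q (Cell x y) = read_cell q x y"
| "compute q (Mem a x) = Get a (T q) (V x)"
| "compute q (Neq x y) =
     Minus (T q) (V x) (V y) ;; Minus (T (Suc q)) (V y) (V x) ;; Plus (T q) (T q) (T (Suc q))"
| "compute q (Nonzero x) = Flag (T q) False ;; Plus (T q) (T q) (V x)"
| "compute q (Neg f) = compute q f ;; Cond (T q) (Flag (T q) False) (Flag (T q) True)"
| "compute q (Conj f g) = compute q f ;; Cond (T q) (compute q g) Skip"
| "compute q (Forall f) =
     Flag (T q) True ;;
     Loop (V q) (V 2) (compute (Suc q) f ;; Cond (T (Suc q)) Skip (Flag (T q) False))"

lemma sem_read_cell: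
  assumes "1 \<le> N"
  shows "sem w N (read_cell q x y) s (T q) =
    input_symbol w (min N (cell_pos (s (V 2)) (s (V x)) (s (V y))))"
proof -
  let ?s = "s(T q := 1)"
  let ?I = "\<lambda>i t. t (T q) = min N (1 + i * s (V 2)) \<and> (\<forall>x. t (V x) = s (V x))"
  have "?I (?s (V x)) (sem w N (Loop (T (Suc q)) (V x) (Plus (T q) (T q) (V 2))) ?s)"
    by (rule sem_Loop_invariant[where I = ?I]) (use assms in \<open>auto simp: min_def\<close>)
  then show ?thesis unfolding read_cell_def
    by (simp add: cell_pos_def del: sem.simps(10)) (simp add: min_def algebra_simps)
qed

lemma mods_read_cell: "mods (read_cell q x y) = {T q, T (Suc q)}"
  by (auto simp: read_cell_def)

text \<open>Evaluation at level q writes only to levels from q on, so tests do not disturb the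
  variables of the surrounding program or its arrays.\<close>

lemma mods_compute: "mods (compute q f) \<subseteq> V ` {q..} \<union> T ` {q..}"
proof (induction f arbitrary: q)
  case (Forall f)
  have "V ` {Suc q..} \<union> T ` {Suc q..} \<subseteq> V ` {q..} \<union> T ` {q..}" by auto
  then show ?case using Forall[of "Suc q"] by auto
qed (auto simp: mods_read_cell)

lemma compute_frame:
  shows "x < q \<Longrightarrow> sem w N (compute q f) s (V x) = s (V x)"
    and "x < q \<Longrightarrow> sem w N (compute q f) s (T x) = s (T x)"
    and "sem w N (compute q f) s (Arr a i) = s (Arr a i)"
  using mods_compute[of q f] by (auto intro!: sem_frame)

text \<open>Computing one conjunct or instance changes the store; this shows that the truth value of
  the next one is unaffected.\<close>

lemma eval_cong:
  assumes "wf_fm q f" "2 < q" "\<And>x. x < q \<Longrightarrow> s (V x) = s' (V x)"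
    and "\<And>a i. s (Arr a i) = s' (Arr a i)"
  shows "eval w N q f s \<longleftrightarrow> eval w N q f s'"
  using assms
proof (induction f arbitrary: q s s')
  case (Conj f g)
  from Conj.IH(1)[of q s s'] Conj.IH(2)[of q s s'] Conj.prems show ?case by simp
next
  case (Neg f)
  from Neg.IH[of q s s'] Neg.prems show ?case by simp
next
  case (Forall f)
  have "eval w N (Suc q) f (s(V q := i)) \<longleftrightarrow> eval w N (Suc q) f (s'(V q := i))" for i
    using Forall.prems by (intro Forall.IH) auto
  then show ?case using Forall.prems by simp
qed auto

lemma compute_correct:
  assumes "wf_fm q f" "2 < q" "1 \<le> N"
  shows "sem w N (compute q f) s (T q) \<noteq> 0 \<longleftrightarrow> eval w N q f s"
  using assms
proof (induction f arbitrary: q s)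
  case (Cell x y)
  then show ?case using sem_read_cell[of N] by simp
next
  case (Conj f g)
  have "eval w N q g (sem w N (compute q f) s) \<longleftrightarrow> eval w N q g s"
    using Conj.prems by (intro eval_cong) (auto simp: compute_frame)
  then show ?case using Conj by auto
next
  case (Neg f)
  then show ?case by auto
next
  case (Forall f)
  let ?c = "compute (Suc q) f ;; Cond (T (Suc q)) Skip (Flag (T q) False)"
  let ?s = "s(T q := 1)"
  let ?I = "\<lambda>i t. (t (T q) \<noteq> 0 \<longleftrightarrow> (\<forall>j<i. eval w N (Suc q) f (s(V q := j)))) \<and>
    (\<forall>x<q. t (V x) = s (V x)) \<and> (\<forall>a i. t (Arr a i) = s (Arr a i))"
  have "?I (?s (V 2)) (sem w N (Loop (V q) (V 2) ?c) ?s)"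
  proof (rule sem_Loop_invariant[where I = ?I])
    fix i t assume t: "?I i t"
    have "eval w N (Suc q) f (t(V q := i)) \<longleftrightarrow> eval w N (Suc q) f (s(V q := i))"
      using t Forall.prems by (intro eval_cong) (auto simp: less_Suc_eq)
    then have "sem w N (compute (Suc q) f) (t(V q := i)) (T (Suc q)) \<noteq> 0 \<longleftrightarrow>
        eval w N (Suc q) f (s(V q := i))"
      using Forall by simp
    then show "?I (Suc i) (sem w N ?c (t(V q := i)))"
      using t by (auto simp: compute_frame less_Suc_eq)
  qed simp
  then show ?case by (simp del: sem.simps(10))
qed (auto simp: min_def)

text \<open>Programs keep their own variables below level 12.\<close>

definition test :: "fm \<Rightarrow> com \<Rightarrow> com \<Rightarrow> com" where
  "test f c1 c2 = compute 12 f ;; Cond (T 12) c1 c2"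

lemma sem_test:
  assumes "wf_fm 12 f" "1 \<le> N"
  shows "sem w N (test f c1 c2) s =
    (if eval w N 12 f s then sem w N c1 (sem w N (compute 12 f) s)
     else sem w N c2 (sem w N (compute 12 f) s))"
  using compute_correct[of 12 f N w s] assms by (simp add: test_def)

lemma compute_12_frame [simp]:
  shows "x < 12 \<Longrightarrow> sem w N (compute 12 f) s (V x) = s (V x)"
    and "sem w N (compute 12 f) s (Arr a i) = s (Arr a i)"
  by (simp_all add: compute_frame)

text \<open>From here on loops are reasoned about by invariants instead of unfolding to
  \<open>fold\<close>, and formulas by their meaning instead of their code.\<close>

declare sem.simps(10) [simp del] compute.simps [simp del] eval.simps(1) [simp del]

lemma mods_test_iff [simp]:
  "x < 12 \<Longrightarrow> V x \<in> mods (test f c1 c2) \<longleftrightarrow> V x \<in> mods c1 \<or> V x \<in> mods c2"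
  "Arr a i \<in> mods (test f c1 c2) \<longleftrightarrow> Arr a i \<in> mods c1 \<or> Arr a i \<in> mods c2"
  using mods_compute[of 12 f] by (auto simp: test_def)


section \<open>The algorithm\<close>

text \<open>
  Variables: 0 answer, 2 number of vertices, 3 best size found so far, 4 current size,
  5 carry of the binary counter, 6 truncated p, 7 to 11 auxiliary. The arrays \<open>False\<close> and
  \<open>True\<close> hold the current subset Y of X and the remaining candidates outside X.
\<close>

definition incr :: "nat \<Rightarrow> com" where
  "incr x = Flag (T 0) True ;; Plus (V x) (V x) (T 0)"

text \<open>With truncated subtraction, \<open>x + (y - x)\<close> is the maximum of x and
  y.\<close>

definition maximize :: "nat \<Rightarrow> nat \<Rightarrow> com" where
  "maximize x y = Minus (T 0) (V y) (V x) ;; Plus (V x) (V x) (T 0)"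

definition assign :: "bool \<Rightarrow> nat \<Rightarrow> bool \<Rightarrow> com" where
  "assign a x b = Flag (T 0) b ;; Put a (V x) (T 0)"

definition compatible_fm :: "bool \<Rightarrow> nat \<Rightarrow> nat \<Rightarrow> fm" where
  "compatible_fm clq x y = (if clq then Cell x y else Neg (Cell x y))"

definition pairwise_fm :: "bool \<Rightarrow> fm" where
  "pairwise_fm clq = Forall (Forall (Neg (Conj (Mem False 12) (Conj (Mem False 13)
     (Conj (Neq 12 13) (Neg (compatible_fm clq 12 13)))))))"

definition extender_fm :: "bool \<Rightarrow> fm" where
  "extender_fm clq =
     Conj (Neg (Cell 2 7)) (Forall (Neg (Conj (Mem False 12) (Neg (compatible_fm clq 7 12)))))"

definition simplicial_fm :: fm where
  "simplicial_fm = Conj (Mem True 8) (Forall (Forall (Neg (Conj (Mem True 12) (Conj (Mem True 13)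
     (Conj (Cell 8 12) (Conj (Cell 8 13) (Conj (Neq 12 13) (Neg (Cell 12 13))))))))))"

definition near_fm :: fm where
  "near_fm = Neg (Conj (Neq 9 8) (Neg (Cell 8 9)))"

definition eliminate :: "bool \<Rightarrow> com" where
  "eliminate clq =
    (if clq then
       Flag (T 0) False ;; Plus (V 11) (V 4) (T 0) ;;
       Loop (V 9) (V 2) (test (Conj (Mem True 9) near_fm) (incr 11) Skip) ;;
       maximize 3 11 ;; assign True 8 False
     else
       incr 4 ;; Loop (V 9) (V 2) (test near_fm (assign True 9 False) Skip))"

text \<open>A deletion can make a vertex simplicial that the sweep has already passed. But each
  sweep over a nonempty set deletes something, so n sweeps are enough.\<close>

definition eliminate_all :: "bool \<Rightarrow> com" where
  "eliminate_all clq =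
     Loop (V 10) (V 2) (Loop (V 8) (V 2) (test simplicial_fm (eliminate clq) Skip))"

definition branch :: "bool \<Rightarrow> com" where
  "branch clq = test (pairwise_fm clq)
     (Flag (V 4) False ;;
      Loop (V 7) (V 2) (test (Mem False 7) (incr 4) Skip) ;;
      Loop (V 7) (V 2) (test (extender_fm clq) (assign True 7 True) (assign True 7 False)) ;;
      eliminate_all clq ;;
      maximize 3 4)
     Skip"

text \<open>Binary increment on the positions in X: members are cleared up to the first nonmember,
  which is inserted and absorbs the carry \<open>V 5\<close>. A carry that is left over signals that
  Y was all of X and ends the enumeration.\<close>

definition next_subset :: com where
  "next_subset = Flag (V 5) True ;;
     Loop (V 7) (V 2) (test (Conj (Cell 2 7) (Nonzero 5))
       (test (Mem False 7) (assign False 7 False) (assign False 7 True ;; Flag (V 5) False))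
       Skip)"

text \<open>Digits 0 to n are summed up with saturation. Position \<open>n + 1\<close> is only
  tested for being inside the input, by comparison with the end marker 2: the digit there may be 0,
  but if it exists, the leading digit makes p at least \<open>2 ^ (n + 1)\<close>, and
  \<open>V 6\<close> receives this power, saturated.\<close>

definition read_target :: com where
  "read_target =
     Flag (T 0) True ;; Plus (V 8) (V 2) (T 0) ;; Flag (V 6) False ;; Flag (V 9) True ;;
     Loop (V 7) (V 8) (
       read_cell 12 8 7 ;;
       Flag (T 0) True ;; Minus (T 0) (T 12) (T 0) ;;
       Cond (T 0) Skip (Cond (T 12) (Plus (V 6) (V 6) (V 9)) Skip) ;;
       Plus (V 9) (V 9) (V 9)) ;;
     read_cell 12 8 8 ;;
     Flag (T 0) True ;; Plus (T 0) (T 0) (T 0) ;; Minus (T 0) (T 0) (T 12) ;;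
     Cond (T 0) (Flag (T 0) False ;; Plus (V 6) (V 9) (T 0)) Skip"

definition compare_target :: com where
  "compare_target =
     Minus (T 0) (V 6) (V 3) ;; Cond (T 0) (Flag (V 0) False) (Flag (V 0) True)"

section \<open>Correctness of elimination, branching and increment\<close>

lemma sem_basic:
  "sem w N (incr x) s = s(T 0 := 1, V x := min N (s (V x) + 1))"
  "sem w N (assign a x b) s = s(T 0 := of_bool b, Arr a (s (V x)) := of_bool b)"
  by (simp_all add: incr_def assign_def)

lemma sem_maximize:
  "s (V x) \<le> N \<Longrightarrow> s (V y) \<le> N \<Longrightarrow> x \<noteq> y \<Longrightarrow>
   sem w N (maximize x y) s = s(T 0 := s (V y) - s (V x), V x := max (s (V x)) (s (V y)))"
  by (simp add: maximize_def max_def min_def)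

lemma mods_basic [simp]:
  "mods (incr x) = {T 0, V x}" "mods (maximize x y) = {T 0, V x}"
  "mods (assign a x b) = insert (T 0) (range (Arr a))"
  by (auto simp: incr_def maximize_def assign_def)

lemma card_less_Suc:
  "card {j. j < Suc i \<and> Q j} = card {j. j < i \<and> Q j} + of_bool (Q i)"
proof (cases "Q i")
  case True
  then have "{j. j < Suc i \<and> Q j} = insert i {j. j < i \<and> Q j}" by (auto simp: less_Suc_eq)
  then show ?thesis using True by simp
next
  case False
  then have "{j. j < Suc i \<and> Q j} = {j. j < i \<and> Q j}" by (auto simp: less_Suc_eq)
  then show ?thesis using False by simp
qed

text \<open>Vertices are replaced by their positions below n, and the interval model by its one
  consequence \<open>elimination\<close>.\<close>

locale graph_input =
  fixes w :: "bool list" and n N :: nat and E :: "nat \<Rightarrow> nat \<Rightarrow> bool" and X :: "nat set" and p :: nat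
  assumes N: "N = bound n"
    and input_edge: "i < n \<Longrightarrow> j < n \<Longrightarrow> input_symbol w (cell_pos n i j) = of_bool (E i j)"
    and input_X: "j < n \<Longrightarrow> input_symbol w (cell_pos n n j) = of_bool (j \<in> X)"
    and input_p: "input_symbol w (cell_pos n (Suc n) j) =
      (if j < bit_length p then of_bool (bit p j) else 2)"
    and sym: "E i j \<longleftrightarrow> E j i" and irrefl: "\<not> E i i"
    and X: "X \<subseteq> {..<n}"
    and elimination: "A \<subseteq> {..<n} - X \<Longrightarrow> A \<noteq> {} \<Longrightarrow> \<exists>v\<in>A. simplicial E A v"
begin

definition compat :: "bool \<Rightarrow> nat \<Rightarrow> nat \<Rightarrow> bool" where
  "compat clq = (if clq then E else (\<lambda>u v. \<not> E u v))"

definition members :: "bool \<Rightarrow> store \<Rightarrow> nat set" where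
  "members a s = {j. j < n \<and> s (Arr a j) \<noteq> 0}"

lemma finite_members [simp]: "finite (members a s)"
  by (simp add: members_def)

lemma n_less_N: "Suc n < N" "1 \<le> N"
  by (simp_all add: N bound_def)

lemma cell_pos_le: "i \<le> Suc n \<Longrightarrow> j \<le> Suc n \<Longrightarrow> cell_pos n i j \<le> N"
  using mult_le_mono1[of i "Suc n" n] by (simp add: cell_pos_def N bound_def)

text \<open>Since \<open>V 2\<close> holds n, \<open>Cell 2 y\<close> looks into row n, which is the
  characteristic vector of X.\<close>

lemma eval_Cell:
  assumes "s (V 2) = n"
  shows "s (V x) < n \<Longrightarrow> s (V y) < n \<Longrightarrow> eval w N q (Cell x y) s \<longleftrightarrow> E (s (V x)) (s (V y))"
    and "s (V y) < n \<Longrightarrow> eval w N q (Cell 2 y) s \<longleftrightarrow> s (V y) \<in> X"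
  using assms by (simp_all add: eval.simps(1) min_absorb2 cell_pos_le input_edge input_X)

lemma eval_compatible:
  "s (V 2) = n \<Longrightarrow> s (V x) < n \<Longrightarrow> s (V y) < n \<Longrightarrow>
   eval w N q (compatible_fm clq x y) s \<longleftrightarrow> compat clq (s (V x)) (s (V y))"
  by (simp add: compatible_fm_def compat_def eval_Cell)

lemma eval_pairwise:
  "s (V 2) = n \<Longrightarrow> eval w N 12 (pairwise_fm clq) s \<longleftrightarrow> pairwise (compat clq) (members False s)"
  by (auto simp: pairwise_fm_def eval_compatible pairwise_def members_def) (metis neq0_conv)

lemma eval_extender:
  "s (V 2) = n \<Longrightarrow> s (V 7) < n \<Longrightarrow> eval w N 12 (extender_fm clq) s \<longleftrightarrow>
     s (V 7) \<in> extenders (compat clq) ({..<n} - X) (members False s)"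
  by (auto simp: extender_fm_def eval_compatible eval_Cell extenders_def members_def)

lemma eval_simplicial:
  "s (V 2) = n \<Longrightarrow> s (V 8) < n \<Longrightarrow> eval w N 12 simplicial_fm s \<longleftrightarrow>
     s (V 8) \<in> members True s \<and> simplicial E (members True s) (s (V 8))"
  by (auto simp: simplicial_fm_def eval_Cell simplicial_def members_def) (metis neq0_conv)

lemma eval_near:
  "s (V 2) = n \<Longrightarrow> s (V 8) < n \<Longrightarrow> s (V 9) < n \<Longrightarrow> eval w N 12 near_fm s \<longleftrightarrow>
     s (V 9) = s (V 8) \<or> E (s (V 8)) (s (V 9))"
  by (auto simp: near_fm_def eval_Cell)

lemma wf_fms [simp]:
  "wf_fm 12 (pairwise_fm clq)" "wf_fm 12 (extender_fm clq)" "wf_fm 12 simplicial_fm"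
  "wf_fm 12 near_fm"
  by (simp_all add: pairwise_fm_def extender_fm_def simplicial_fm_def near_fm_def compatible_fm_def)

text \<open>The last assumption keeps the counter from saturating. The test may depend on the index
  alone, as everything else it reads is unchanged since loop entry.\<close>

lemma sem_count_loop:
  assumes "a < 12" "x < 12" "a \<noteq> x" "a \<noteq> 2" "x \<noteq> 2" "wf_fm 12 f" "s (V 2) = n"
    and f: "\<And>i t. i < n \<Longrightarrow> t (V a) = i \<Longrightarrow> (\<And>y. y < 12 \<Longrightarrow> y \<noteq> a \<Longrightarrow> y \<noteq> x \<Longrightarrow> t (V y) = s (V y)) \<Longrightarrow>
      (\<And>b j. t (Arr b j) = s (Arr b j)) \<Longrightarrow> eval w N 12 f t \<longleftrightarrow> Q i"
    and le: "s (V x) + card {j. j < n \<and> Q j} \<le> N"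
  shows "sem w N (Loop (V a) (V 2) (test f (incr x) Skip)) s (V x) = s (V x) + card {j. j < n \<and> Q j}"
proof -
  let ?I = "\<lambda>i t. t (V x) = s (V x) + card {j. j < i \<and> Q j}"
  have "?I (s (V 2)) (sem w N (Loop (V a) (V 2) (test f (incr x) Skip)) s)"
  proof (rule sem_Loop_invariant_frame[where I = ?I])
    fix i t
    assume i: "i < s (V 2)" and I: "?I i t"
      and fr: "\<And>l. l \<noteq> V a \<Longrightarrow> l \<notin> mods (test f (incr x) Skip) \<Longrightarrow> t l = s l"
    have "eval w N 12 f (t(V a := i)) \<longleftrightarrow> Q i"
      by (rule f) (use i fr assms in auto)
    moreover have "card {j. j < Suc i \<and> Q j} \<le> card {j. j < n \<and> Q j}"
      using i assms by (intro card_mono) auto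
    ultimately show "?I (Suc i) (sem w N (test f (incr x) Skip) (t(V a := i)))"
      using I assms(1-7) le n_less_N by (auto simp: sem_test sem_basic card_less_Suc)
  qed simp
  then show ?thesis using assms by simp
qed

text \<open>The best size still within reach. Cliques found are recorded in \<open>V 3\<close>,
  vertices chosen for an independent set are counted in \<open>V 4\<close>; this quantity is
  invariant in both cases and is the result once no candidates are left.\<close>

definition potential :: "bool \<Rightarrow> store \<Rightarrow> nat" where
  "potential clq s = max (s (V 3)) (s (V 4) + max_pairwise (compat clq) (members True s))"

text \<open>The two identities for simplicial vertices preserve the potential. Its bound n keeps all
  sums formed on the way below N, so saturation does not interfere.\<close>

lemma eliminate_correct:
  assumes s: "s (V 2) = n" and v: "s (V 8) \<in> members True s"
      "simplicial E (members True s) (s (V 8))"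
    and le: "potential clq s \<le> n"
  shows "potential clq (sem w N (eliminate clq) s) = potential clq s"
    and "members True (sem w N (eliminate clq) s) \<subseteq> members True s - {s (V 8)}"
proof -
  let ?v = "s (V 8)" and ?A = "members True s"
  have vn: "?v < n" using v by (simp add: members_def)
  have "potential clq (sem w N (eliminate clq) s) = potential clq s \<and>
    members True (sem w N (eliminate clq) s) \<subseteq> ?A - {?v}"
  proof (cases clq)
    case False
    let ?c = "test near_fm (assign True 9 False) Skip"
    let ?s = "sem w N (incr 4) s"
    let ?t = "sem w N (Loop (V 9) (V 2) ?c) ?s"
    let ?I = "\<lambda>i t. \<forall>j. t (Arr True j) = (if j < i \<and> (j = ?v \<or> E ?v j) then 0 else s (Arr True j))"
    have "?I (?s (V 2)) ?t"
    proof (rule sem_Loop_invariant_frame[where I = ?I])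
      fix i t
      assume i: "i < ?s (V 2)" and I: "?I i t"
        and fr: "\<And>l. l \<noteq> V 9 \<Longrightarrow> l \<notin> mods ?c \<Longrightarrow> t l = ?s l"
      have "t (V 2) = n" "t (V 8) = ?v" using fr[of "V 2"] fr[of "V 8"] s by (auto simp: sem_basic)
      then have "eval w N 12 near_fm (t(V 9 := i)) \<longleftrightarrow> i = ?v \<or> E ?v i"
        using i s vn by (subst eval_near) (auto simp: sem_basic)
      then show "?I (Suc i) (sem w N ?c (t(V 9 := i)))"
        using I n_less_N by (auto simp: sem_test sem_basic less_Suc_eq)
    qed (simp add: sem_basic)
    then have "members True ?t = {u \<in> ?A. u \<noteq> ?v \<and> \<not> E ?v u}"
      using s by (auto simp: members_def sem_basic split: if_splits)
    moreover have "?t (V 3) = s (V 3)" by (subst sem_frame) (auto simp: sem_basic)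
    moreover have "?t (V 4) = ?s (V 4)" by (subst sem_frame) auto
    moreover have mx: "max_pairwise (compat clq) ?A =
        Suc (max_pairwise (compat clq) {u \<in> ?A. u \<noteq> ?v \<and> \<not> E ?v u})"
      using False max_independent_simplicial[OF _ sym v] by (simp add: compat_def)
    moreover have "?s (V 4) = Suc (s (V 4))"
      using le n_less_N mx by (simp add: sem_basic potential_def)
    moreover have "sem w N (eliminate clq) s = ?t" using False by (simp add: eliminate_def)
    ultimately show ?thesis by (simp only: potential_def) auto
  next
    case True
    let ?f = "Conj (Mem True 9) near_fm"
    let ?c = "Loop (V 9) (V 2) (test ?f (incr 11) Skip)"
    let ?s = "s(T 0 := 0, V 11 := min N (s (V 4)))"
    let ?t = "sem w N ?c ?s"
    let ?N = "{u \<in> ?A. u = ?v \<or> E ?v u}"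
    have mx: "max_pairwise (compat clq) ?A = max (card ?N) (max_pairwise (compat clq) (?A - {?v}))"
      using True max_clique_simplicial[OF _ sym v] by (simp add: compat_def)
    have N_eq: "?N = {j. j < n \<and> (s (Arr True j) \<noteq> 0 \<and> (j = ?v \<or> E ?v j))}"
      by (auto simp: members_def)
    have le': "s (V 3) \<le> n" "s (V 4) + card ?N \<le> n" using le mx by (auto simp: potential_def)
    have "?t (V 11) = ?s (V 11) + card {j. j < n \<and> (s (Arr True j) \<noteq> 0 \<and> (j = ?v \<or> E ?v j))}"
    proof (rule sem_count_loop)
      fix i t assume "i < n" "t (V 9) = i"
        "\<And>y. y < 12 \<Longrightarrow> y \<noteq> 9 \<Longrightarrow> y \<noteq> 11 \<Longrightarrow> t (V y) = ?s (V y)" "\<And>b j. t (Arr b j) = ?s (Arr b j)"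
      then show "eval w N 12 ?f t \<longleftrightarrow> s (Arr True i) \<noteq> 0 \<and> (i = ?v \<or> E ?v i)"
        using s vn by (simp add: eval_near)
    qed (use s le' N_eq n_less_N in auto)
    then have t11: "?t (V 11) = s (V 4) + card ?N" using le' n_less_N N_eq by simp
    have t: "?t (V 3) = s (V 3)" "?t (V 4) = s (V 4)" "?t (V 8) = ?v"
        "?t (Arr True j) = s (Arr True j)" for j
      by (subst sem_frame; auto)+
    have "sem w N (eliminate clq) s = sem w N (maximize 3 11 ;; assign True 8 False) ?t"
      using True by (simp add: eliminate_def)
    also have "\<dots> = ?t(T 0 := 0, V 3 := max (s (V 3)) (s (V 4) + card ?N), Arr True ?v := 0)"
      using t t11 le' n_less_N by (auto simp: sem_maximize sem_basic)
    finally have r: "sem w N (eliminate clq) s = \<dots>" .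
    have "members True (sem w N (eliminate clq) s) = ?A - {?v}"
      unfolding r by (auto simp: members_def t)
    then show ?thesis
      unfolding potential_def mx by (simp add: r t)
  qed
  then show "potential clq (sem w N (eliminate clq) s) = potential clq s"
    "members True (sem w N (eliminate clq) s) \<subseteq> members True s - {s (V 8)}" by auto
qed

lemma members_upd [simp]:
  "members a (s(V x := i)) = members a s" "members a (s(T x := i)) = members a s"
  "members a (s(Arr a j := 0)) = members a s - {j}"
  "j < n \<Longrightarrow> members a (s(Arr a j := Suc 0)) = insert j (members a s)"
  by (auto simp: members_def)

lemma potential_upd [simp]:
  "x \<noteq> 3 \<Longrightarrow> x \<noteq> 4 \<Longrightarrow> potential clq (s(V x := i)) = potential clq s"
  by (simp add: potential_def)

lemma compute_members [simp]: "members a (sem w N (compute 12 f) s) = members a s"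
  by (simp add: members_def)

lemma compute_potential [simp]: "potential clq (sem w N (compute 12 f) s) = potential clq s"
  by (simp add: potential_def)

lemma mods_eliminate:
  "V x \<in> mods (eliminate clq) \<Longrightarrow> x < 12 \<Longrightarrow> x \<in> {3, 4, 9, 11}"
  "Arr False j \<notin> mods (eliminate clq)"
  by (auto simp: eliminate_def split: if_splits)

lemma mods_eliminate_all:
  "V x \<in> mods (eliminate_all clq) \<Longrightarrow> x < 12 \<Longrightarrow> x \<in> {3, 4, 8, 9, 10, 11}"
  "Arr False j \<notin> mods (eliminate_all clq)"
  using mods_eliminate(1)[of x clq] mods_eliminate(2)[of j clq] by (auto simp: eliminate_all_def)

lemma eliminate_all_correct:
  assumes s: "s (V 2) = n" and le: "potential clq s \<le> n" and A: "members True s \<subseteq> {..<n} - X"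
  shows "potential clq (sem w N (eliminate_all clq) s) = potential clq s"
    and "members True (sem w N (eliminate_all clq) s) = {}"
proof -
  let ?K = "potential clq s"
  let ?d = "test simplicial_fm (eliminate clq) Skip"
  let ?c = "Loop (V 8) (V 2) ?d"
  let ?I = "\<lambda>i t. potential clq t = ?K \<and> members True t \<subseteq> {..<n} - X \<and> card (members True t) \<le> n - i"
  have n2: "V 2 \<notin> mods ?d" using mods_eliminate(1)[of 2 clq] by auto
  have "?I (s (V 2)) (sem w N (Loop (V 10) (V 2) ?c) s)"
  proof (rule sem_Loop_invariant_frame[where I = ?I])
    have "card (members True s) \<le> card {..<n}" using A by (intro card_mono) auto
    then show "?I 0 s" using A by simp
  next
    fix i t
    assume i: "i < s (V 2)" and I: "?I i t" and fr: "\<And>l. l \<noteq> V 10 \<Longrightarrow> l \<notin> mods ?c \<Longrightarrow> t l = s l"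
    let ?t = "t(V 10 := i)" and ?A = "members True t"
    have tn: "?t (V 2) = n" using fr[of "V 2"] n2 s by simp
    \<comment> \<open>A sweep that deletes nothing has refuted simpliciality of every candidate with
      respect to the unchanged set \<open>?A\<close>, which \<open>elimination\<close> excludes
      unless \<open>?A\<close> is empty.\<close>
    let ?J = "\<lambda>j u. potential clq u = ?K \<and> members True u \<subseteq> ?A \<and>
      (members True u = ?A \<longrightarrow> (\<forall>v\<in>?A. v < j \<longrightarrow> \<not> simplicial E ?A v))"
    have J: "?J (?t (V 2)) (sem w N ?c ?t)"
    proof (rule sem_Loop_invariant_frame[where I = ?J])
      fix j u
      assume j: "j < ?t (V 2)" and J: "?J j u" and fr: "\<And>l. l \<noteq> V 8 \<Longrightarrow> l \<notin> mods ?d \<Longrightarrow> u l = ?t l"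
      let ?u = "sem w N (compute 12 simplicial_fm) (u(V 8 := j))"
      have un: "u (V 2) = n" using fr[of "V 2"] n2 tn by simp
      have ev: "eval w N 12 simplicial_fm (u(V 8 := j)) \<longleftrightarrow>
          j \<in> members True u \<and> simplicial E (members True u) j"
        using un j tn by (subst eval_simplicial) auto
      show "?J (Suc j) (sem w N ?d (u(V 8 := j)))"
      proof (cases "j \<in> members True u \<and> simplicial E (members True u) j")
        case True
        then have "sem w N ?d (u(V 8 := j)) = sem w N (eliminate clq) ?u"
          using ev n_less_N by (simp add: sem_test)
        moreover have "potential clq (sem w N (eliminate clq) ?u) = potential clq ?u"
          "members True (sem w N (eliminate clq) ?u) \<subseteq> members True ?u - {?u (V 8)}"
          by (rule eliminate_correct; use un True J le in simp)+
        ultimately show ?thesis using J True by auto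
      next
        case False
        then have "sem w N ?d (u(V 8 := j)) = ?u"
          using ev n_less_N by (auto simp: sem_test)
        then show ?thesis using J False by (auto simp: less_Suc_eq)
      qed
    qed (use I in auto)
    have "card (members True (sem w N ?c ?t)) \<le> n - Suc i"
    proof (cases "?A = {}")
      case False
      then have "members True (sem w N ?c ?t) \<noteq> ?A"
        using J elimination[of ?A] I tn by (auto simp: members_def)
      then have "members True (sem w N ?c ?t) \<subset> ?A" using J by blast
      then have "card (members True (sem w N ?c ?t)) < card ?A" by (intro psubset_card_mono) auto
      then show ?thesis using I by linarith
    qed (use J in auto)
    then show "?I (Suc i) (sem w N ?c ?t)" using J I by blast
  qed
  then show "potential clq (sem w N (eliminate_all clq) s) = potential clq s"
    "members True (sem w N (eliminate_all clq) s) = {}"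
    using s by (simp_all add: eliminate_all_def)
qed

text \<open>Keeps the best size in \<open>V 3\<close> at most n, safely below the saturation
  bound.\<close>

lemma branch_value_le:
  assumes "Y \<subseteq> X"
  shows "branch_value (compat clq) ({..<n} - X) Y \<le> n"
proof -
  have "branch_value (compat clq) ({..<n} - X) Y
      \<le> Max (insert 0 (branch_value (compat clq) ({..<n} - X) ` Pow X))"
    using assms X by (intro Max_ge) (auto intro: finite_subset)
  also have "\<dots> = max_pairwise (compat clq) {..<n}"
    by (rule max_pairwise_branch) (use X sym in \<open>auto simp: compat_def\<close>)
  also have "\<dots> \<le> n" using max_pairwise_le_card[of "{..<n}"] by simp
  finally show ?thesis .
qed

lemma branch_correct:
  assumes s: "s (V 2) = n" "s (V 3) \<le> n" and Y: "members False s \<subseteq> X"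
  shows "sem w N (branch clq) s (V 3) =
    max (s (V 3)) (branch_value (compat clq) ({..<n} - X) (members False s))"
proof (cases "pairwise (compat clq) (members False s)")
  case False
  then have "sem w N (branch clq) s = sem w N (compute 12 (pairwise_fm clq)) s"
    using n_less_N s by (simp add: branch_def sem_test eval_pairwise)
  then show ?thesis using False by (simp add: branch_value_def)
next
  case True
  let ?Y = "members False s"
  let ?ext = "extenders (compat clq) ({..<n} - X) ?Y"
  let ?c1 = "Loop (V 7) (V 2) (test (Mem False 7) (incr 4) Skip)"
  let ?d = "test (extender_fm clq) (assign True 7 True) (assign True 7 False)"
  let ?c2 = "Loop (V 7) (V 2) ?d"
  define s1 where "s1 = (sem w N (compute 12 (pairwise_fm clq)) s)(V 4 := 0)"
  define s2 where "s2 = sem w N ?c1 s1"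
  define s3 where "s3 = sem w N ?c2 s2"
  define s4 where "s4 = sem w N (eliminate_all clq) s3"
  have sem: "sem w N (branch clq) s = sem w N (maximize 3 4) s4"
    using n_less_N s True
    by (simp add: branch_def sem_test eval_pairwise s1_def s2_def s3_def s4_def)
  have s1: "s1 (V 2) = n" "s1 (V 3) = s (V 3)" "s1 (V 4) = 0"
      "\<And>j. s1 (Arr False j) = s (Arr False j)"
    using s by (simp_all add: s1_def)
  have "s2 (V 4) = s1 (V 4) + card {j. j < n \<and> s (Arr False j) \<noteq> 0}"
    unfolding s2_def
  proof (rule sem_count_loop)
    have "card {j. j < n \<and> s (Arr False j) \<noteq> 0} \<le> card {..<n}" by (intro card_mono) auto
    then show "s1 (V 4) + card {j. j < n \<and> s (Arr False j) \<noteq> 0} \<le> N" using s1 n_less_N by simp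
  qed (use s1 in auto)
  then have "s2 (V 4) = card ?Y" using s1 by (simp add: members_def)
  moreover have "s2 (V 2) = n" "s2 (V 3) = s (V 3)" "\<And>j. s2 (Arr False j) = s (Arr False j)"
    unfolding s2_def by (subst sem_frame; use s1 in auto)+
  ultimately have s2: "s2 (V 2) = n" "s2 (V 3) = s (V 3)" "s2 (V 4) = card ?Y"
    "members False s2 = ?Y" by (simp_all add: members_def)
  let ?I = "\<lambda>i t. \<forall>j<i. t (Arr True j) \<noteq> 0 \<longleftrightarrow> j \<in> ?ext"
  have "?I (s2 (V 2)) s3"
    unfolding s3_def
  proof (rule sem_Loop_invariant_frame[where I = ?I])
    fix i t
    assume i: "i < s2 (V 2)" and I: "?I i t" and fr: "\<And>l. l \<noteq> V 7 \<Longrightarrow> l \<notin> mods ?d \<Longrightarrow> t l = s2 l"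
    have "t (V 2) = n" using fr[of "V 2"] s2(1) by auto
    moreover have "t (Arr False j) = s2 (Arr False j)" for j using fr[of "Arr False j"] by auto
    then have "members False t = members False s2" by (simp add: members_def)
    ultimately have "eval w N 12 (extender_fm clq) (t(V 7 := i)) \<longleftrightarrow> i \<in> ?ext"
      using i s2 by (subst eval_extender) auto
    then show "?I (Suc i) (sem w N ?d (t(V 7 := i)))"
      using I n_less_N by (auto simp: sem_test sem_basic less_Suc_eq)
  qed simp
  then have A: "members True s3 = ?ext" using s2(1) by (auto simp: members_def extenders_def)
  have s3: "s3 (V 2) = n" "s3 (V 3) = s (V 3)" "s3 (V 4) = card ?Y"
    unfolding s3_def by (subst sem_frame; use s2 in auto)+
  have pot: "potential clq s3 = max (s (V 3)) (branch_value (compat clq) ({..<n} - X) ?Y)"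
    using True by (simp add: potential_def s3 A branch_value_def)
  then have le: "potential clq s3 \<le> n" using s branch_value_le[OF Y] by simp
  have "members True s3 \<subseteq> {..<n} - X" unfolding A by (auto simp: extenders_def)
  from eliminate_all_correct[OF s3(1) le this]
  have "potential clq s4 = potential clq s3" "members True s4 = {}" by (simp_all add: s4_def)
  \<comment> \<open>No candidates are left, so the potential consists of the two variables
    alone.\<close>
  then have "max (s4 (V 3)) (s4 (V 4)) = potential clq s3" by (simp add: potential_def)
  then show ?thesis using le n_less_N pot unfolding sem by (subst sem_maximize) auto
qed

lemma mods_branch:
  "V x \<in> mods (branch clq) \<Longrightarrow> x < 12 \<Longrightarrow> x \<in> {3, 4, 7, 8, 9, 10, 11}"
  "Arr False j \<notin> mods (branch clq)"
  using mods_eliminate_all(1)[of x clq] mods_eliminate_all(2)[of j clq] by (auto simp: branch_def)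

text \<open>The outcomes are overflow and a position m that meets the hypotheses of
  \<open>colex_below_successor\<close>.\<close>

lemma next_subset_correct:
  assumes s: "s (V 2) = n" and Y: "members False s \<subseteq> X"
  defines "s' \<equiv> sem w N next_subset s" and "Y \<equiv> members False s"
  obtains "s' (V 5) \<noteq> 0" "Y = X"
  | m where "s' (V 5) = 0" "m \<in> X" "m \<notin> Y" "\<And>x. x \<in> X \<Longrightarrow> x < m \<Longrightarrow> x \<in> Y"
      "members False s' = insert m {x \<in> Y. m < x}"
proof -
  let ?d = "test (Mem False 7) (assign False 7 False) (assign False 7 True ;; Flag (V 5) False)"
  let ?c = "test (Conj (Cell 2 7) (Nonzero 5)) ?d Skip"
  let ?s = "s(V 5 := 1)"
  \<comment> \<open>Here m is where the carry is absorbed. While the carry is alive, X below i was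
    contained in Y and has been cleared; after m the array is final.\<close>
  let ?stop = "\<lambda>i t m. m < i \<and> t (V 5) = 0 \<and> m \<in> X \<and> m \<notin> Y \<and> (\<forall>x\<in>X. x < m \<longrightarrow> x \<in> Y) \<and>
      members False t = insert m {x \<in> Y. m < x}"
  let ?I = "\<lambda>i t. (t (V 5) \<noteq> 0 \<and> (\<forall>x\<in>X. x < i \<longrightarrow> x \<in> Y) \<and> members False t = {x \<in> Y. i \<le> x}) \<or>
    (\<exists>m. ?stop i t m)"
  have "?I (?s (V 2)) (sem w N (Loop (V 7) (V 2) ?c) ?s)"
  proof (rule sem_Loop_invariant_frame[where I = ?I])
    show "?I 0 ?s" by (simp add: Y_def)
  next
    fix i t
    assume i: "i < ?s (V 2)" and I: "?I i t" and fr: "\<And>l. l \<noteq> V 7 \<Longrightarrow> l \<notin> mods ?c \<Longrightarrow> t l = ?s l"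
    have t2: "t (V 2) = n" using fr[of "V 2"] s by auto
    have i: "i < n" using i s by simp
    let ?t1 = "sem w N (compute 12 (Conj (Cell 2 7) (Nonzero 5))) (t(V 7 := i))"
    let ?t2 = "sem w N (compute 12 (Mem False 7)) ?t1"
    show "?I (Suc i) (sem w N ?c (t(V 7 := i)))"
    proof (cases "i \<in> X \<and> t (V 5) \<noteq> 0")
      case False
      then have "sem w N ?c (t(V 7 := i)) = ?t1"
        using t2 i n_less_N by (auto simp: sem_test eval_Cell)
      moreover have "?t1 (V 5) = t (V 5)" "members False ?t1 = members False t" by simp_all
      moreover have "?I (Suc i) t"
      proof (cases "t (V 5) = 0")
        case True
        then show ?thesis using I less_Suc_eq by auto
      next
        case t5: False
        then have "i \<notin> X" using False by simp
        then have "{x \<in> Y. i \<le> x} = {x \<in> Y. Suc i \<le> x}"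
          using assms by (auto simp: Suc_le_eq le_less)
        then show ?thesis using I t5 \<open>i \<notin> X\<close> by (auto simp: less_Suc_eq)
      qed
      ultimately show ?thesis by simp
    next
      case True
      then have I': "\<forall>x\<in>X. x < i \<longrightarrow> x \<in> Y" "members False t = {x \<in> Y. i \<le> x}" using I by auto
      have "t (Arr False i) \<noteq> 0 \<longleftrightarrow> i \<in> Y" using I'(2) i by (auto simp: members_def)
      then have sem: "sem w N ?c (t(V 7 := i)) =
          (if i \<in> Y then ?t2(T 0 := 0, Arr False i := 0)
           else ?t2(T 0 := 1, Arr False i := 1, V 5 := 0))"
        using t2 i True n_less_N by (simp add: sem_test sem_basic eval_Cell)
      have mem: "members False ?t2 = {x \<in> Y. i \<le> x}" using I' by simp
      show ?thesis
      proof (cases "i \<in> Y")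
        case iY: True
        have "members False (sem w N ?c (t(V 7 := i))) = {x \<in> Y. Suc i \<le> x}"
          unfolding sem using iY by (simp only: if_True members_upd mem) (auto simp: Suc_le_eq)
        moreover have "sem w N ?c (t(V 7 := i)) (V 5) = t (V 5)" unfolding sem using iY by simp
        ultimately show ?thesis using True I'(1) iY by (auto simp: less_Suc_eq)
      next
        case False
        have "members False (sem w N ?c (t(V 7 := i))) = insert i {x \<in> Y. i < x}"
          unfolding sem using i False by (simp only: if_False members_upd One_nat_def mem) auto
        moreover have "sem w N ?c (t(V 7 := i)) (V 5) = 0" unfolding sem using False by simp
        ultimately have "?stop (Suc i) (sem w N ?c (t(V 7 := i))) i"
          using True I'(1) False by simp
        then show ?thesis by blast
      qed
    qed
  qed
  then have "(s' (V 5) \<noteq> 0 \<and> (\<forall>x\<in>X. x < n \<longrightarrow> x \<in> Y)) \<or> (\<exists>m. ?stop n s' m)"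
    using s unfolding s'_def next_subset_def by simp blast
  then consider "s' (V 5) \<noteq> 0" "\<forall>x\<in>X. x < n \<longrightarrow> x \<in> Y" | m where "?stop n s' m" by blast
  then show thesis
  proof cases
    case 1
    then show thesis using that(1) X Y unfolding Y_def by blast
  next
    case (2 m)
    then show thesis by (intro that(2)[of m]) auto
  qed
qed

end

lemma less_exp_bit_length: "m < 2 ^ bit_length m"
  using floor_log_exp2_gt[of m] by (simp add: bit_length_def)

lemma exp_le_if_less_bit_length:
  assumes "j < bit_length m" "0 < m"
  shows "2 ^ j \<le> m"
proof -
  have "(2::nat) ^ j \<le> 2 ^ floor_log m" using assms(1) by (simp add: bit_length_def)
  also have "\<dots> \<le> m" using assms(2) by (rule floor_log_exp2_le)
  finally show ?thesis .
qed

context graph_input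
begin

text \<open>Only comparisons with sizes up to n matter. With at most \<open>n + 1\<close> digits,
  \<open>V 6\<close> is p up to saturation; with more, both p and \<open>V 6\<close> exceed
  n.\<close>

lemma read_target_correct:
  assumes s: "s (V 2) = n" and p: "0 < p" and m: "m \<le> n"
  shows "sem w N read_target s (V 6) \<le> m \<longleftrightarrow> p \<le> m"
proof -
  let ?c = "read_cell 12 8 7 ;;
       Flag (T 0) True ;; Minus (T 0) (T 12) (T 0) ;;
       Cond (T 0) Skip (Cond (T 12) (Plus (V 6) (V 6) (V 9)) Skip) ;;
       Plus (V 9) (V 9) (V 9)"
  let ?s = "s(T 0 := 1, V 8 := Suc n, V 6 := 0, V 9 := 1)"
  let ?t = "sem w N (Loop (V 7) (V 8) ?c) ?s"
  let ?I = "\<lambda>i t. t (V 6) = min N (take_bit i p) \<and> t (V 9) = min N (2 ^ i)"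
  have bit: "\<not> bit p i" if "bit_length p \<le> i" for i
  proof -
    have "p < 2 ^ i" using less_exp_bit_length[of p] that
      by (meson less_le_trans one_le_numeral power_increasing)
    then show ?thesis by (simp add: bit_iff_odd)
  qed
  have frame: "sem w N (read_cell 12 x y) t (V z) = t (V z)" for x y z t
    by (rule sem_frame) (simp add: mods_read_cell)
  have "?I (?s (V 8)) ?t"
  proof (rule sem_Loop_invariant_frame[where I = ?I])
    show "?I 0 ?s" using n_less_N by simp
  next
    fix i t
    assume i: "i < ?s (V 8)" and I: "?I i t" and fr: "\<And>l. l \<noteq> V 7 \<Longrightarrow> l \<notin> mods ?c \<Longrightarrow> t l = ?s l"
    let ?t1 = "sem w N (read_cell 12 8 7) (t(V 7 := i))"
    have "t (V 8) = Suc n" "t (V 2) = n"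
      using fr[of "V 8"] fr[of "V 2"] s by (auto simp: mods_read_cell)
    then have sym: "?t1 (T 12) = (if i < bit_length p then of_bool (bit p i) else 2)"
      using i n_less_N by (simp add: sem_read_cell min_absorb2 cell_pos_le input_p)
    \<comment> \<open>Saturating the operands first does not change a saturated sum, so the loop
      computes the saturation of the exact values.\<close>
    have plus: "min N (min N a + min N b) = min N (a + b)" for a b by (simp add: min_def)
    show "?I (Suc i) (sem w N ?c (t(V 7 := i)))"
    proof (cases "bit p i")
      case True
      then have "i < bit_length p" using bit[of i] by (meson not_less)
      then have "?t1 (T 12) = 1" using sym True by simp
      then show ?thesis
        using I True by (simp add: frame plus take_bit_Suc_from_most mult_2 add.commute)
    next
      case False
      then have "?t1 (T 12) = 0 \<or> ?t1 (T 12) = 2" using sym by auto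
      then show ?thesis
        using I False by (auto simp: frame plus take_bit_Suc_from_most mult_2)
    qed
  qed
  then have t: "?t (V 6) = min N (take_bit (Suc n) p)" "?t (V 9) = min N (2 ^ Suc n)" by simp_all
  have t': "?t (V 8) = Suc n" "?t (V 2) = n"
    by (subst sem_frame; use s in \<open>auto simp: mods_read_cell\<close>)+
  let ?u = "sem w N (read_cell 12 8 8) ?t"
  have sym: "?u (T 12) = (if Suc n < bit_length p then of_bool (bit p (Suc n)) else 2)"
    using t' n_less_N by (simp add: sem_read_cell min_absorb2 cell_pos_le input_p)
  have "2 \<le> N" using n_less_N by simp
  have sem: "sem w N read_target s (V 6) =
      (if Suc n < bit_length p then min N (2 ^ Suc n) else min N (take_bit (Suc n) p))"
  proof -
    have "sem w N read_target s = sem w N (read_cell 12 8 8 ;;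
       Flag (T 0) True ;; Plus (T 0) (T 0) (T 0) ;; Minus (T 0) (T 0) (T 12) ;;
       Cond (T 0) (Flag (T 0) False ;; Plus (V 6) (V 9) (T 0)) Skip) ?t"
      using s n_less_N by (simp add: read_target_def)
    then show ?thesis using sym \<open>2 \<le> N\<close> t by (simp add: frame)
  qed
  show ?thesis
  proof (cases "Suc n < bit_length p")
    case True
    have "n < 2 ^ Suc n" using less_exp[of "Suc n"] by simp
    moreover have "2 ^ Suc n \<le> p" using True p by (rule exp_le_if_less_bit_length)
    ultimately show ?thesis using sem True m n_less_N by (simp add: min_def)
  next
    case False
    have "p < 2 ^ Suc n"
      using False less_exp_bit_length[of p]
      by (meson less_le_trans not_less one_le_numeral power_increasing)
    then show ?thesis using sem False m n_less_N by (simp add: min_def take_bit_nat_eq_self)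
  qed
qed

lemma compare_target_correct:
  "sem w N compare_target s (V 0) = of_bool (s (V 6) \<le> s (V 3))"
  by (simp add: compare_target_def)

section \<open>The rounds of the enumeration\<close>

definition best_in :: "bool \<Rightarrow> nat set \<Rightarrow> nat" where
  "best_in clq = branch_value (compat clq) ({..<n} - X)"

text \<open>The number j of finished rounds is tied to the number of subsets below the counter,
  which is what limits the rounds.\<close>

definition round_invariant :: "bool \<Rightarrow> nat \<Rightarrow> nat \<Rightarrow> store \<Rightarrow> bool" where
  "round_invariant clq q j s \<longleftrightarrow> s (V 2) = n \<and> s (V 6) = q \<and> members False s \<subseteq> X \<and>
     card (colex_below X (members False s)) = j \<and>
     s (V 3) = Max (insert 0 (best_in clq ` colex_below X (members False s)))"

lemma finite_X: "finite X"
  using X by (rule finite_subset) simp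

lemma finite_colex_below: "finite (colex_below X Y)"
  using finite_X by (simp add: colex_below_def)

text \<open>The j finished subsets and the current one, which is not below itself, are distinct
  subsets of X; hence j is less than \<open>2 ^ card X\<close>.\<close>

lemma round_correct:
  assumes inv: "round_invariant clq q j s"
  defines "s' \<equiv> sem w N (branch clq ;; next_subset) s"
  shows "j < 2 ^ card X"
    and "s' (V 5) = 0 \<Longrightarrow> round_invariant clq q (Suc j) s'"
    and "s' (V 5) \<noteq> 0 \<Longrightarrow> s' (V 3) = max_pairwise (compat clq) {..<n} \<and> s' (V 6) = q"
proof -
  let ?Y = "members False s"
  let ?D = "colex_below X ?Y"
  have s: "s (V 2) = n" "s (V 6) = q" and Y: "?Y \<subseteq> X" and j: "card ?D = j"
    and best: "s (V 3) = Max (insert 0 (best_in clq ` ?D))"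
    using inv by (auto simp: round_invariant_def)
  have "?Y \<notin> ?D" by (simp add: colex_below_def colex_less_irrefl)
  then have card: "card (insert ?Y ?D) = Suc j" using j finite_colex_below by simp
  have "insert ?Y ?D \<subseteq> Pow X" using Y by (auto simp: colex_below_def)
  then have "card (insert ?Y ?D) \<le> card (Pow X)" using finite_X by (intro card_mono) auto
  then show "j < 2 ^ card X" using card finite_X by (simp add: card_Pow)
  have "s (V 3) \<le> n"
    unfolding best using finite_colex_below branch_value_le
    by (auto simp: best_in_def colex_below_def)
  define t where "t = sem w N (branch clq) s"
  have "t (V 3) = max (s (V 3)) (best_in clq ?Y)"
    unfolding t_def best_in_def by (rule branch_correct) (use s Y \<open>s (V 3) \<le> n\<close> in auto)
  also have "\<dots> = Max (insert 0 (best_in clq ` insert ?Y ?D))"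
    unfolding best using finite_colex_below
    by (simp add: insert_commute[of 0] max.commute)
  finally have t3: "t (V 3) = \<dots>" .
  have t: "t (V 2) = n" "t (V 6) = q" and tY: "t (Arr False i) = s (Arr False i)" for i
    unfolding t_def using mods_branch(1)[of 2 clq] mods_branch(1)[of 6 clq] mods_branch(2) s
    by (subst sem_frame; force)+
  have tY: "members False t = ?Y" using tY by (simp add: members_def)
  have s': "s' = sem w N next_subset t" by (simp add: s'_def t_def)
  have fr: "s' (V 2) = n" "s' (V 3) = t (V 3)" "s' (V 6) = q"
    unfolding s' by (subst sem_frame; auto simp: next_subset_def t)+
  have Y': "members False t \<subseteq> X" using Y tY by simp
  show "round_invariant clq q (Suc j) s'" if "s' (V 5) = 0"
  proof (rule next_subset_correct[OF t(1) Y', folded s', unfolded tY])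
    fix m assume m: "m \<in> X" "m \<notin> ?Y" "\<And>x. x \<in> X \<Longrightarrow> x < m \<Longrightarrow> x \<in> ?Y"
      "members False s' = insert m {x \<in> ?Y. m < x}"
    have "colex_below X (members False s') = insert ?Y ?D"
      unfolding m(4) by (rule colex_below_successor[OF finite_X Y m(1-3)])
    moreover have "members False s' \<subseteq> X" using m Y by auto
    ultimately show ?thesis using fr t3 card by (simp add: round_invariant_def)
  qed (use that in simp)
  show "s' (V 3) = max_pairwise (compat clq) {..<n} \<and> s' (V 6) = q" if "s' (V 5) \<noteq> 0"
  proof (rule next_subset_correct[OF t(1) Y', folded s', unfolded tY])
    assume "?Y = X"
    then have "insert ?Y ?D = Pow X" using colex_below_full[OF finite_X] by simp
    then have "s' (V 3) = Max (insert 0 (best_in clq ` Pow X))" using fr(2) t3 by simp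
    also have "\<dots> = max_pairwise (compat clq) {..<n}"
      unfolding best_in_def
      by (rule max_pairwise_branch) (use X sym in \<open>auto simp: compat_def\<close>)
    finally show ?thesis using fr by simp
  qed (use that in simp)
qed

definition initial :: store where
  "initial = sem w N read_target ((\<lambda>_. 0)(V 2 := n))"

text \<open>M is the first positive index at which the carry flag is set. Since rounds before it
  satisfy the invariant, there is such an index, and it is at most
  \<open>2 ^ card X\<close>.\<close>

lemma rounds_correct:
  fixes clq :: bool
  assumes p: "0 < p"
  defines "st \<equiv> \<lambda>j. (sem w N (branch clq ;; next_subset) ^^ j) initial"
  obtains M where "0 < M" "M \<le> 2 ^ card X" "st M (V 5) \<noteq> 0" "\<And>j. 0 < j \<Longrightarrow> j < M \<Longrightarrow> st j (V 5) = 0"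
    "sem w N compare_target (st M) (V 0) = of_bool (p \<le> max_pairwise (compat clq) {..<n})"
proof -
  let ?q = "initial (V 6)"
  have fr: "initial (V 2) = n" "initial (V 3) = 0" "initial (Arr a i) = 0" for a i
    unfolding initial_def by (subst sem_frame; simp add: read_target_def mods_read_cell)+
  \<comment> \<open>The arrays start out as zero, so the counter shows the empty set, which has
    nothing below it.\<close>
  have 0: "round_invariant clq ?q 0 (st 0)"
    using fr by (simp add: round_invariant_def st_def members_def)
  have st_Suc: "st (Suc j) = sem w N (branch clq ;; next_subset) (st j)" for j by (simp add: st_def)
  have inv: "round_invariant clq ?q j (st j)" if "\<And>i. 0 < i \<Longrightarrow> i \<le> j \<Longrightarrow> st i (V 5) = 0" for j
    using that
  proof (induction j)
    case (Suc j)
    then have "round_invariant clq ?q j (st j)" by simp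
    from round_correct(2)[OF this] Suc.prems[OF zero_less_Suc order_refl]
    show ?case unfolding st_Suc .
  qed (simp add: 0)
  have "\<exists>M. 0 < M \<and> st M (V 5) \<noteq> 0"
  proof (rule ccontr)
    assume "\<not> (\<exists>M. 0 < M \<and> st M (V 5) \<noteq> 0)"
    then have "round_invariant clq ?q (2 ^ card X) (st (2 ^ card X))" by (intro inv) blast
    from round_correct(1)[OF this] show False by simp
  qed
  then have ex: "\<exists>M. 0 < M \<and> st M (V 5) \<noteq> 0" .
  define M where "M = (LEAST M. 0 < M \<and> st M (V 5) \<noteq> 0)"
  have M: "0 < M" "st M (V 5) \<noteq> 0" using LeastI_ex[OF ex] by (simp_all add: M_def)
  have less: "st j (V 5) = 0" if "0 < j" "j < M" for j
    using not_less_Least[of j "\<lambda>M. 0 < M \<and> st M (V 5) \<noteq> 0"] that by (auto simp: M_def)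
  obtain j where j: "M = Suc j" using M by (cases M) auto
  have I: "round_invariant clq ?q j (st j)" using less j by (intro inv) auto
  have "st M (V 3) = max_pairwise (compat clq) {..<n}" "st M (V 6) = ?q"
    using round_correct(3)[OF I] M(2) by (simp_all add: j st_Suc)
  moreover have "max_pairwise (compat clq) {..<n} \<le> n"
    using max_pairwise_le_card[of "{..<n}"] by simp
  ultimately have "st M (V 6) \<le> st M (V 3) \<longleftrightarrow> p \<le> max_pairwise (compat clq) {..<n}"
    unfolding initial_def using read_target_correct[OF _ p] by simp
  then have "sem w N compare_target (st M) (V 0) = of_bool (p \<le> max_pairwise (compat clq) {..<n})"
    by (simp add: compare_target_correct)
  moreover have "M \<le> 2 ^ card X" using round_correct(1)[OF I] j by simp
  ultimately show thesis using that M less by blast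
qed

end

section \<open>Encoded instances\<close>

lemma length_concat_rows: "length (concat (map (\<lambda>u. map (f u) vs) us)) = length us * length vs"
  by (induction us) simp_all

lemma nth_concat_rows:
  "i < length us \<Longrightarrow> j < length vs \<Longrightarrow>
   concat (map (\<lambda>u. map (f u) vs) us) ! (i * length vs + j) = f (us ! i) (vs ! j)"
proof (induction us arbitrary: i)
  case (Cons u us)
  then show ?case by (cases i) (simp_all add: nth_append add.assoc)
qed simp

lemma input_symbol_append:
  "i < length xs \<Longrightarrow> input_symbol (xs @ ys) i = of_bool (xs ! i)"
  "input_symbol (xs @ ys) (length xs + i) = input_symbol ys i"
  by (simp_all add: input_symbol_def nth_append)

lemma input_symbol_encode_instance:
  fixes G X p
  defines "w \<equiv> encode_instance G X p" and "vs \<equiv> sorted_list_of_set (pverts G)"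
    and "n \<equiv> card (pverts G)"
  shows "i < n \<Longrightarrow> input_symbol w i = 1"
    and "input_symbol w n = 0"
    and "i < n \<Longrightarrow> j < n \<Longrightarrow>
      input_symbol w (cell_pos n i j) = of_bool ((vs ! i, vs ! j) \<in> parcs G)"
    and "j < n \<Longrightarrow> input_symbol w (cell_pos n n j) = of_bool (vs ! j \<in> X)"
    and "input_symbol w (cell_pos n (Suc n) j) =
      (if j < bit_length p then of_bool (bit p j) else 2)"
proof -
  let ?head = "replicate n True @ [False]"
  let ?rows = "concat (map (\<lambda>u. map (\<lambda>v. (u, v) \<in> parcs G) vs) vs)"
  let ?X = "map (\<lambda>v. v \<in> X) vs"
  let ?p = "map (bit p) [0..<bit_length p]"
  have n: "length vs = n" by (simp add: vs_def n_def)
  have w: "w = ?head @ ?rows @ ?X @ ?p"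
    by (simp add: w_def encode_instance_def Let_def vs_def n_def)
  have rows: "length ?rows = n * n" using n by (simp add: length_concat_rows)
  show "input_symbol w i = 1" if "i < n"
    unfolding w using that by (subst input_symbol_append(1)) (auto simp: nth_append)
  show "input_symbol w n = 0"
    unfolding w by (subst input_symbol_append(1)) (auto simp: nth_append)
  have pos: "input_symbol w (cell_pos n i j) = input_symbol (?rows @ ?X @ ?p) (i * n + j)" for i j
    using input_symbol_append(2)[of ?head "?rows @ ?X @ ?p" "i * n + j"]
    by (simp add: w cell_pos_def add.assoc)
  show "input_symbol w (cell_pos n i j) = of_bool ((vs ! i, vs ! j) \<in> parcs G)"
    if "i < n" "j < n"
  proof -
    have "i * n + j < Suc i * n" using that by simp
    also have "\<dots> \<le> n * n" using that by (intro mult_le_mono1) simp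
    finally show ?thesis
      unfolding pos using that rows n nth_concat_rows[of i vs j vs "\<lambda>u v. (u, v) \<in> parcs G"]
      by (subst input_symbol_append(1)) simp_all
  qed
  have tail: "input_symbol w (cell_pos n n j) = input_symbol (?X @ ?p) j" for j
    unfolding pos using input_symbol_append(2)[of ?rows "?X @ ?p" j] rows by simp
  show "input_symbol w (cell_pos n n j) = of_bool (vs ! j \<in> X)" if "j < n"
    unfolding tail using that n by (subst input_symbol_append(1)) simp_all
  have "cell_pos n (Suc n) j = cell_pos n n (n + j)" by (simp add: cell_pos_def)
  then show "input_symbol w (cell_pos n (Suc n) j) = (if j < bit_length p then of_bool (bit p j) else 2)"
    using tail[of "n + j"] input_symbol_append(2)[of ?X ?p j] n by (simp add: input_symbol_def)
qed

text \<open>Transfers solutions between the vertices of the graph and their positions in the sorted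
  list, on which the program works.\<close>

lemma ex_pairwise_bij_betw:
  assumes "bij_betw f A B"
  shows "(\<exists>S. S \<subseteq> B \<and> pairwise Q S \<and> card S = m) \<longleftrightarrow>
    (\<exists>S. S \<subseteq> A \<and> pairwise (\<lambda>i j. Q (f i) (f j)) S \<and> card S = m)"
proof -
  have B: "B = f ` A" and inj: "inj_on f A" using assms by (auto simp: bij_betw_def)
  have image: "pairwise Q (f ` S) \<longleftrightarrow> pairwise (\<lambda>i j. Q (f i) (f j)) S" "card (f ` S) = card S"
    if "S \<subseteq> A" for S
  proof -
    have injS: "inj_on f S" using inj that by (rule inj_on_subset)
    then show "card (f ` S) = card S" by (rule card_image)
    have "f i = f j \<longleftrightarrow> i = j" if "i \<in> S" "j \<in> S" for i j using injS that by (rule inj_on_eq_iff)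
    then show "pairwise Q (f ` S) \<longleftrightarrow> pairwise (\<lambda>i j. Q (f i) (f j)) S"
      by (simp add: pairwise_def)
  qed
  have "(\<exists>S. S \<subseteq> B \<and> pairwise Q S \<and> card S = m) \<longleftrightarrow>
      (\<exists>S. S \<subseteq> A \<and> pairwise Q (f ` S) \<and> card (f ` S) = m)"
    unfolding B subset_image_iff by blast
  also have "\<dots> \<longleftrightarrow> (\<exists>S. S \<subseteq> A \<and> pairwise (\<lambda>i j. Q (f i) (f j)) S \<and> card S = m)"
    using image by (simp cong: conj_cong)
  finally show ?thesis .
qed

definition adjacency :: "bool \<Rightarrow> 'a pair_pre_digraph \<Rightarrow> 'a \<Rightarrow> 'a \<Rightarrow> bool" where
  "adjacency clq G u v \<longleftrightarrow> ((u, v) \<in> parcs G \<longleftrightarrow> clq)"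

lemma independent_in_iff:
  "independent_in (with_proj G) S \<longleftrightarrow> S \<subseteq> pverts G \<and> pairwise (adjacency False G) S"
  by (auto simp: independent_in_def pairwise_def adjacency_def)

lemma clique_in_iff:
  "clique_in (with_proj G) S \<longleftrightarrow> S \<subseteq> pverts G \<and> pairwise (adjacency True G) S"
  by (auto simp: clique_in_def pairwise_def adjacency_def)

lemma interval_graph_delete_verts:
  assumes "interval_graph (delete_verts (with_proj G) X)"
  obtains l r :: "'a \<Rightarrow> real" where "\<And>v. v \<in> pverts G - X \<Longrightarrow> l v \<le> r v"
    "\<And>u v. u \<in> pverts G - X \<Longrightarrow> v \<in> pverts G - X \<Longrightarrow> u \<noteq> v \<Longrightarrow>
      (u, v) \<in> parcs G \<longleftrightarrow> {l u..r u} \<inter> {l v..r v} \<noteq> {}"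
proof -
  have adj: "u \<rightarrow>\<^bsub>delete_verts (with_proj G) X\<^esub> v \<longleftrightarrow> (u, v) \<in> parcs G"
    if "u \<in> pverts G - X" "v \<in> pverts G - X" for u v
    using that by (force simp: delete_verts_def arcs_ends_def arc_to_ends_def)
  have "verts (delete_verts (with_proj G) X) = pverts G - X" by (simp add: delete_verts_def)
  then show thesis using assms that adj unfolding interval_graph_def by (metis (no_types, lifting))
qed

text \<open>Any set of positions outside X inherits the intervals of its vertices and therefore
  contains a simplicial one.\<close>

lemma graph_input_encode_instance:
  fixes G :: "nat pair_pre_digraph" and X p
  defines "n \<equiv> card (pverts G)" and "vs \<equiv> sorted_list_of_set (pverts G)"
  assumes G: "pair_graph G" and interval: "interval_graph (delete_verts (with_proj G) X)"
  shows "graph_input (encode_instance G X p) n (bound n)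
    (\<lambda>i j. i < n \<and> j < n \<and> (vs ! i, vs ! j) \<in> parcs G) {i. i < n \<and> vs ! i \<in> X} p"
    (is "graph_input _ _ _ ?E ?X _")
proof -
  interpret pair_graph G by (rule G)
  have fin: "finite (pverts G)" by (rule pair_finite_verts)
  have vs: "vs ! i \<in> pverts G" if "i < n" for i
    using that fin nth_mem[of i vs] by (simp add: vs_def n_def)
  have inj: "vs ! i = vs ! j \<longleftrightarrow> i = j" if "i < n" "j < n" for i j
    using that fin by (simp add: vs_def n_def nth_eq_iff_index_eq)
  have sym: "(u, v) \<in> parcs G \<Longrightarrow> (v, u) \<in> parcs G" for u v
    using pair_sym_arcs by (auto simp: symmetric_def dest: symD)
  have irr: "(v, v) \<notin> parcs G" for v using pair_no_loops[of "(v, v)"] by auto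
  obtain l r :: "nat \<Rightarrow> real" where lr: "\<And>v. v \<in> pverts G - X \<Longrightarrow> l v \<le> r v"
    "\<And>u v. u \<in> pverts G - X \<Longrightarrow> v \<in> pverts G - X \<Longrightarrow> u \<noteq> v \<Longrightarrow>
      (u, v) \<in> parcs G \<longleftrightarrow> {l u..r u} \<inter> {l v..r v} \<noteq> {}"
    using interval_graph_delete_verts[OF interval] by blast
  note input = input_symbol_encode_instance[where G = G and X = X and p = p,
      folded n_def vs_def]
  show ?thesis
  proof
    show "\<exists>v\<in>A. simplicial ?E A v" if A: "A \<subseteq> {..<n} - ?X" "A \<noteq> {}" for A
    proof (rule interval_model_simplicial[where l = "\<lambda>i. l (vs ! i)" and r = "\<lambda>i. r (vs ! i)"])
      have A': "vs ! i \<in> pverts G - X" "i < n" if "i \<in> A" for i using that A vs by auto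
      show "l (vs ! v) \<le> r (vs ! v)" if "v \<in> A" for v using A'[OF that] lr(1) by blast
      show "?E u v \<longleftrightarrow> {l (vs ! u)..r (vs ! u)} \<inter> {l (vs ! v)..r (vs ! v)} \<noteq> {}"
        if "u \<in> A" "v \<in> A" "u \<noteq> v" for u v
        using that A' lr(2)[of "vs ! u" "vs ! v"] inj by auto
    qed (use A irr in \<open>auto intro: finite_subset\<close>)
  qed (use input sym irr in auto)
qed

lemma decides_within_mono:
  "decides_within prog w ans t s \<Longrightarrow> t \<le> t' \<Longrightarrow> s \<le> s' \<Longrightarrow> decides_within prog w ans t' s'"
  unfolding decides_within_def by (meson le_trans)

text \<open>One program serves all k: the number of rounds is determined by X, and
  \<open>card X <= k\<close> enters only the estimate.\<close>

lemma pairwise_search_in_time: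
  "\<exists>prog t s. poly_bounded t \<and> poly_bounded s \<and>
     (\<forall>(G :: nat pair_pre_digraph) X k p.
        pair_graph G \<and> X \<subseteq> pverts G \<and> card X \<le> k \<and>
        interval_graph (delete_verts (with_proj G) X) \<and> 0 < p \<longrightarrow>
        decides_within prog (encode_instance G X p)
          (\<exists>S. S \<subseteq> pverts G \<and> pairwise (adjacency clq G) S \<and> card S = p)
          (2 ^ k * t (card (pverts G))) (s (card (pverts G))))"
proof -
  define c where "c = (branch clq ;; next_subset)"
  define prog where "prog = complete_program read_target c (V 5) compare_target"
  \<comment> \<open>The program is fixed, so its largest operand is a constant and \<open>B\<close>
    is polynomial in n.\<close>
  define B where "B n = 4 * bound n + 3 + Max (operand_bound ` set prog)" for n
  define steps where "steps n = 9 * n + 3 + time (bound n) read_target + (time (bound n) c + 1) +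
    time (bound n) compare_target" for n
  have bound: "poly_growth bound" unfolding bound_def[abs_def] by simp
  have polyB: "poly_growth B" unfolding B_def[abs_def] using bound by simp
  have polyT: "poly_growth steps" unfolding steps_def[abs_def] using bound by (simp add: poly_growth_time)
  show ?thesis
  proof (intro exI conjI allI impI)
    show "poly_bounded (\<lambda>n. steps n * (5 * Suc (B n)))" "poly_bounded (\<lambda>n. 2 * Suc (B n) * Suc (B n))"
      using polyB polyT by (intro poly_growth_poly_bounded; simp)+
    fix G :: "nat pair_pre_digraph" and X :: "nat set" and k p :: nat
    assume "pair_graph G \<and> X \<subseteq> pverts G \<and> card X \<le> k \<and>
        interval_graph (delete_verts (with_proj G) X) \<and> 0 < p"
    then have G: "pair_graph G" and modulator: "X \<subseteq> pverts G" "card X \<le> k"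
      and interval: "interval_graph (delete_verts (with_proj G) X)" and p: "0 < p" by auto
    define n where "n = card (pverts G)"
    define vs where "vs = sorted_list_of_set (pverts G)"
    define w where "w = encode_instance G X p"
    let ?E = "\<lambda>i j. i < n \<and> j < n \<and> (vs ! i, vs ! j) \<in> parcs G"
    let ?X = "{i. i < n \<and> vs ! i \<in> X}"
    interpret graph_input w n "bound n" ?E ?X p
      unfolding w_def n_def vs_def by (rule graph_input_encode_instance[OF G interval])
    interpret machine prog w "bound n" "B n"
    proof
      show "operand_bound i \<le> B n" if "i \<in> set prog" for i
        unfolding B_def using that by (intro trans_le_add2 Max_ge) auto
    qed (simp_all add: B_def bound_def)
    have fin: "finite (pverts G)" by (rule pair_fin_digraph.pair_finite_verts)
      (use G in \<open>simp add: pair_graph_def pair_digraph_def\<close>)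
    have bij: "bij_betw ((!) vs) {..<n} (pverts G)"
      using fin by (intro bij_betw_nth) (simp_all add: vs_def n_def)
    have "card ?X \<le> card X"
    proof (rule card_inj_on_le)
      show "inj_on ((!) vs) ?X" using bij by (auto simp: bij_betw_def intro: inj_on_subset)
    qed (use modulator fin in \<open>auto intro: finite_subset\<close>)
    then have card: "(2::nat) ^ card ?X \<le> 2 ^ k" using modulator by (intro power_increasing) auto
    obtain M where M: "0 < M" "M \<le> 2 ^ card ?X"
      "((sem w (bound n) c ^^ M) initial) (V 5) \<noteq> 0"
      "\<And>j. 0 < j \<Longrightarrow> j < M \<Longrightarrow> ((sem w (bound n) c ^^ j) initial) (V 5) = 0"
      "sem w (bound n) compare_target ((sem w (bound n) c ^^ M) initial) (V 0) =
        of_bool (p \<le> max_pairwise (compat clq) {..<n})"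
      by (rule rounds_correct[OF p, where clq = clq, folded c_def], rule that)
    note input = input_symbol_encode_instance[where G = G and X = X and p = p, folded n_def w_def]
    obtain m R where m: "m \<le> 9 * n + 3 + time (bound n) read_target +
        M * (time (bound n) c + 1) + time (bound n) compare_target"
      "runs (0, \<lambda>_. 0) m (length prog, R)"
      "represents R (sem w (bound n) compare_target ((sem w (bound n) c ^^ M) initial))"
      by (rule runs_complete_program[OF prog_def refl input(1,2) refl M(1)])
        (use M(3,4) in \<open>simp_all add: initial_def\<close>)
    have "R 0 = of_bool (p \<le> max_pairwise (compat clq) {..<n})"
      using represents_simps(1)[OF m(3), of "V 0"] M(5) by simp
    moreover have "(\<exists>S. S \<subseteq> pverts G \<and> pairwise (adjacency clq G) S \<and> card S = p) \<longleftrightarrow>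
        p \<le> max_pairwise (compat clq) {..<n}"
    proof -
      have "pairwise (\<lambda>i j. adjacency clq G (vs ! i) (vs ! j)) S \<longleftrightarrow> pairwise (compat clq) S"
        if "S \<subseteq> {..<n}" for S
        using that by (auto simp: pairwise_def adjacency_def compat_def subset_iff)
      then show ?thesis
        using ex_pairwise_bij_betw[OF bij, of "adjacency clq G" p]
          ex_pairwise_card_iff[of "{..<n}" "compat clq" p] by auto
    qed
    ultimately have "decides_within prog w
        (\<exists>S. S \<subseteq> pverts G \<and> pairwise (adjacency clq G) S \<and> card S = p)
        (m * (5 * Suc (B n))) (2 * Suc (B n) * Suc (B n))"
      using decides_within_if_runs[OF m(2)] by simp
    moreover have "m \<le> 2 ^ k * steps n"
    proof -
      have "M \<le> 2 ^ k" using M(2) card by (rule le_trans)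
      then have "M * (time (bound n) c + 1) \<le> 2 ^ k * (time (bound n) c + 1)" by (rule mult_le_mono1)
      \<comment> \<open>Start-up and final comparison run once; they are absorbed into the common
        factor \<open>2 ^ k\<close>, which is at least 1.\<close>
      moreover have "a \<le> 2 ^ k * a" for a :: nat by simp
      then have "9 * n + 3 + time (bound n) read_target + time (bound n) compare_target \<le>
        2 ^ k * (9 * n + 3 + time (bound n) read_target + time (bound n) compare_target)" .
      ultimately show ?thesis using m(1) by (simp add: steps_def algebra_simps)
    qed
    then have "m * (5 * Suc (B n)) \<le> 2 ^ k * (steps n * (5 * Suc (B n)))"
      unfolding mult.assoc[symmetric] by (intro mult_le_mono1)
    ultimately show "decides_within prog (encode_instance G X p)
        (\<exists>S. S \<subseteq> pverts G \<and> pairwise (adjacency clq G) S \<and> card S = p)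
        (2 ^ k * (steps (card (pverts G)) * (5 * Suc (B (card (pverts G))))))
        (2 * Suc (B (card (pverts G))) * Suc (B (card (pverts G))))"
      unfolding w_def n_def by (rule decides_within_mono) simp_all
  qed
qed

theorem theorem5:
  shows
    "(\<exists>prog t s. poly_bounded t \<and> poly_bounded s \<and>
       (\<forall>(G :: nat pair_pre_digraph) X k p.
          pair_graph G \<and> X \<subseteq> pverts G \<and> card X \<le> k \<and>
          interval_graph (delete_verts (with_proj G) X) \<and> 0 < p \<longrightarrow>
          decides_within prog (encode_instance G X p)
            (\<exists>S. independent_in (with_proj G) S \<and> card S = p)
            (2 ^ k * t (card (pverts G)))
            (s (card (pverts G)))))
     \<and>
     (\<exists>prog t s. poly_bounded t \<and> poly_bounded s \<and>
       (\<forall>(G :: nat pair_pre_digraph) X k p.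
          pair_graph G \<and> X \<subseteq> pverts G \<and> card X \<le> k \<and>
          interval_graph (delete_verts (with_proj G) X) \<and> 0 < p \<longrightarrow>
          decides_within prog (encode_instance G X p)
            (\<exists>S. clique_in (with_proj G) S \<and> card S = p)
            (2 ^ k * t (card (pverts G)))
            (s (card (pverts G)))))"
  using pairwise_search_in_time[of False] pairwise_search_in_time[of True]
  by (simp only: independent_in_iff clique_in_iff conj_assoc)

end
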